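(* Let $X$ be a complex Banach space, let $\sigma\subset\mathbb{C}$ be nonempty and compact, and let $T\in B(X)$ be a compact $AC(\sigma)$ operator with splitting $T=A+iB$, where $A,B\in B(X)$ are commuting well-bounded operators. Let $\omega=\alpha+i\beta\in\mathbb{C}$ with $\alpha,\beta\in\mathbb{R}$. Then the unique splitting of $\omega T$ is $$\omega T=(\alpha A-\beta B)+i(\alpha B+\beta A);$$ that is, $\alpha A-\beta B$ and $\alpha B+\beta A$ are commuting well-bounded operators, and they are the only commuting well-bounded operators $U,V\in B(X)$ with $\omega T=U+iV$.
   Context: $B(X)$ is the algebra of bounded linear operators on $X$. An operator $S\in B(X)$ is well-bounded if there are a compact interval $[a,b]\subset\mathbb{R}$ and a constant $C$ such that $\|p(S)\|\le C\bigl(|p(b)|+\int_a^b|p'(t)|\,dt\bigr)$ for all polynomials $p$ (equivalently, $S$ has an $AC[a,b]$ functional calculus). A splitting of an operator $T$ is an expression $T=A+iB$ with $A,B\in B(X)$ commuting well-bounded operators; every $AC(\sigma)$ operator has a splitting, and for a compact $AC(\sigma)$ operator it is unique. Definitions of $BV(\sigma)$ and $AC(\sigma)$. Let $\sigma\subset\mathbb{C}$ be nonempty and compact. For a piecewise linear curve $\gamma:[0,1]\to\mathbb{C}$ (continuous, and affine on each interval of some finite partition of $[0,1]$) and a (real) line $\ell$ in the plane, an entry point of $\gamma$ on $\ell$ is a parameter $t\in[0,1]$ with $\gamma(t)\in\ell$ such that either $t=0$, or for every $\epsilon>0$ there is $s\in(t-\epsilon,t)\cap[0,1]$ with $\gamma(s)\notin\ell$.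 The variation factor $\operatorname{vf}(\gamma)$ is the maximum over all lines $\ell$ of the number of entry points of $\gamma$ on $\ell$, and $\rho(\gamma)=1/\operatorname{vf}(\gamma)$. For $f:\sigma\to\mathbb{C}$, $\operatorname{cvar}(f,\gamma)$ is the supremum of $\sum_{i=1}^{k-1}|f(\gamma(s_{i+1}))-f(\gamma(s_i))|$ over all finite lists $0\le s_1<\dots<s_k\le 1$ with all $\gamma(s_i)\in\sigma$ (zero if there are none). Set $\operatorname{var}(f,\sigma)=\sup_\gamma \operatorname{cvar}(f,\gamma)\rho(\gamma)$, the supremum being over all piecewise linear curves, and $\|f\|_{BV(\sigma)}=\sup_\sigma|f|+\operatorname{var}(f,\sigma)$. $BV(\sigma)$ is the Banach algebra of functions with $\|f\|_{BV(\sigma)}<\infty$, and $AC(\sigma)$ is the closure in $BV(\sigma)$ of the polynomials in $z$ and $\overline{z}$ (restricted to $\sigma$). An operator $T\in B(X)$ is an $AC(\sigma)$ operator if it admits an $AC(\sigma)$ functional calculus, i.e. there is a continuous unital algebra homomorphism $\Psi:AC(\sigma)\to B(X)$ with $\Psi(\boldsymbol{\lambda})=T$, where $\boldsymbol{\lambda}(z)=z$. *)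

theory Defs
  imports "HOL-Analysis.Analysis" "HOL-Computational_Algebra.Polynomial"
begin

text \<open>Complex Banach spaces. The library only has the real class \<open>banach\<close>; the complex
  scalar multiplication is required to extend the real one and to be compatible with the norm.\<close>

class scaleC =
  fixes scaleC :: "complex \<Rightarrow> 'a \<Rightarrow> 'a"  (infixr "*\<^sub>C" 75)

class complex_banach = scaleC + banach +
  assumes scaleC_add_right: "c *\<^sub>C (x + y) = c *\<^sub>C x + c *\<^sub>C y"
    and scaleC_add_left: "(c + d) *\<^sub>C x = c *\<^sub>C x + d *\<^sub>C x"
    and scaleC_scaleC: "c *\<^sub>C (d *\<^sub>C x) = (c * d) *\<^sub>C x"
    and scaleC_of_real: "of_real r *\<^sub>C x = r *\<^sub>R x"
    and norm_scaleC: "norm (c *\<^sub>C x) = norm c * norm x"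

instantiation complex :: complex_banach
begin
definition scaleC_complex :: "complex \<Rightarrow> complex \<Rightarrow> complex" where
  "scaleC_complex c x = c * x"
instance
  by standard (simp_all add: scaleC_complex_def algebra_simps norm_mult scaleR_conv_of_real)
end

lemma bounded_linear_scaleC: "bounded_linear (\<lambda>x::'a::complex_banach. c *\<^sub>C x)"
proof (rule bounded_linear_intro)
  fix r and x y :: 'a
  show "c *\<^sub>C (x + y) = c *\<^sub>C x + c *\<^sub>C y"
    by (rule scaleC_add_right)
  show "c *\<^sub>C (r *\<^sub>R x) = r *\<^sub>R (c *\<^sub>C x)"
    by (metis scaleC_of_real scaleC_scaleC mult.commute)
  show "norm (c *\<^sub>C x) \<le> norm x * norm c"
    by (simp add: norm_scaleC)
qed

text \<open>Operators are given the pointwise scalar multiplication \<open>(c *\<^sub>C T) x = c *\<^sub>C T x\<close>.\<close>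

instantiation blinfun :: (real_normed_vector, complex_banach) complex_banach
begin
lift_definition scaleC_blinfun :: "complex \<Rightarrow> ('a \<Rightarrow>\<^sub>L 'b) \<Rightarrow> ('a \<Rightarrow>\<^sub>L 'b)"
  is "\<lambda>c T x. c *\<^sub>C T x"
  by (rule bounded_linear_compose[OF bounded_linear_scaleC])
instance
proof
  fix c d :: complex and r :: real and S T :: "'a \<Rightarrow>\<^sub>L 'b"
  show "c *\<^sub>C (S + T) = c *\<^sub>C S + c *\<^sub>C T"
    by transfer (simp add: scaleC_add_right)
  show "(c + d) *\<^sub>C T = c *\<^sub>C T + d *\<^sub>C T"
    by transfer (simp add: scaleC_add_left)
  show "c *\<^sub>C (d *\<^sub>C T) = (c * d) *\<^sub>C T"
    by transfer (simp add: scaleC_scaleC)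
  show "of_real r *\<^sub>C T = r *\<^sub>R T"
    by transfer (simp add: scaleC_of_real)
  have le: "norm (c *\<^sub>C T) \<le> norm c * norm T" for c and T :: "'a \<Rightarrow>\<^sub>L 'b"
    by (rule norm_blinfun_bound)
      (auto simp: scaleC_blinfun.rep_eq norm_scaleC mult.assoc intro: mult_left_mono norm_blinfun)
  show "norm (c *\<^sub>C T) = norm c * norm T"
  proof (cases "c = 0")
    case True
    then show ?thesis using le[of c T] by simp
  next
    case False
    have "T = inverse c *\<^sub>C (c *\<^sub>C T)"
      using False scaleC_of_real[of 1, where ?'a = 'b]
      by (intro blinfun_eqI) (simp add: scaleC_blinfun.rep_eq scaleC_scaleC)
    then have "norm T \<le> norm (inverse c) * norm (c *\<^sub>C T)"
      using le[of "inverse c" "c *\<^sub>C T"] by simp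
    with False le[of c T] show ?thesis
      by (simp add: norm_inverse norm_divide field_simps)
  qed
qed
end

text \<open>\<open>B(X)\<close>: the elements of \<open>'a \<Rightarrow>\<^sub>L 'a\<close> are only real linear. The norm on this
  type is the operator norm.\<close>

definition bounded_ops :: "('a::complex_banach \<Rightarrow>\<^sub>L 'a) set" where
  "bounded_ops = {T. \<forall>c x. blinfun_apply T (c *\<^sub>C x) = c *\<^sub>C blinfun_apply T x}"

definition compact_operator :: "('a::complex_banach \<Rightarrow>\<^sub>L 'a) \<Rightarrow> bool" where
  "compact_operator T \<longleftrightarrow> compact (closure (blinfun_apply T ` cball 0 1))"

definition poly_op :: "complex poly \<Rightarrow> ('a::complex_banach \<Rightarrow>\<^sub>L 'a) \<Rightarrow> ('a \<Rightarrow>\<^sub>L 'a)" where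
  "poly_op p S = (\<Sum>i\<le>degree p. coeff p i *\<^sub>C ((blinfun_compose S ^^ i) id_blinfun))"

definition well_bounded :: "('a::complex_banach \<Rightarrow>\<^sub>L 'a) \<Rightarrow> bool" where
  "well_bounded S \<longleftrightarrow> S \<in> bounded_ops \<and>
    (\<exists>a b C :: real. a \<le> b \<and>
      (\<forall>p. norm (poly_op p S) \<le>
        C * (cmod (poly p (of_real b)) +
             integral {a..b} (\<lambda>t. cmod (poly (pderiv p) (of_real t))))))"

definition splitting ::
    "('a::complex_banach \<Rightarrow>\<^sub>L 'a) \<Rightarrow> ('a \<Rightarrow>\<^sub>L 'a) \<Rightarrow> ('a \<Rightarrow>\<^sub>L 'a) \<Rightarrow> bool" where
  "splitting T A B \<longleftrightarrow>
    well_bounded A \<and> well_bounded B \<and> A o\<^sub>L B = B o\<^sub>L A \<and> T = A + \<i> *\<^sub>C B"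

text \<open>Curves are functions on \<open>real\<close> of which only the values on \<open>{0..1}\<close> matter.\<close>

definition pl_curve :: "(real \<Rightarrow> complex) \<Rightarrow> bool" where
  "pl_curve \<gamma> \<longleftrightarrow> continuous_on {0..1} \<gamma> \<and>
    (\<exists>(n::nat) (t::nat \<Rightarrow> real). t 0 = 0 \<and> t n = 1 \<and>
      (\<forall>i<n. t i < t (Suc i) \<and>
        (\<exists>u v. \<forall>s\<in>{t i..t (Suc i)}. \<gamma> s = u + of_real s * v)))"

definition lines :: "complex set set" where
  "lines = {l. \<exists>p v. v \<noteq> 0 \<and> l = range (\<lambda>t::real. p + of_real t * v)}"

definition entry_points :: "(real \<Rightarrow> complex) \<Rightarrow> complex set \<Rightarrow> real set" where
  "entry_points \<gamma> l = {t\<in>{0..1}. \<gamma> t \<in> l \<and>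
    (t = 0 \<or> (\<forall>\<epsilon>>0. \<exists>s\<in>{t - \<epsilon><..<t} \<inter> {0..1}. \<gamma> s \<notin> l))}"

text \<open>For a piecewise linear curve made of \<open>n\<close> affine pieces, every line has at most \<open>n + 1\<close> entry
  points, so \<open>card\<close> is the genuine number of entry points and the supremum (in \<open>nat\<close>) is a
  maximum. It is positive because of the lines through \<open>\<gamma> 0\<close>.\<close>

definition vf :: "(real \<Rightarrow> complex) \<Rightarrow> nat" where
  "vf \<gamma> = (SUP l\<in>lines. card (entry_points \<gamma> l))"

definition rho :: "(real \<Rightarrow> complex) \<Rightarrow> real" where
  "rho \<gamma> = 1 / real (vf \<gamma>)"

text \<open>A function on \<open>\<sigma>\<close> is represented by any function on \<open>complex\<close> extending it: the quantities
  below depend only on the values on \<open>\<sigma>\<close>. Suprema are taken in \<open>ennreal\<close>, so that they may be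
  infinite.\<close>

definition cvar :: "(complex \<Rightarrow> complex) \<Rightarrow> complex set \<Rightarrow> (real \<Rightarrow> complex) \<Rightarrow> ennreal" where
  "cvar f \<sigma> \<gamma> =
    (SUP s\<in>{s::real list. sorted_wrt (<) s \<and> set s \<subseteq> {0..1} \<and> \<gamma> ` set s \<subseteq> \<sigma>}.
      ennreal (\<Sum>i<length s - 1. cmod (f (\<gamma> (s ! Suc i)) - f (\<gamma> (s ! i)))))"

definition var :: "(complex \<Rightarrow> complex) \<Rightarrow> complex set \<Rightarrow> ennreal" where
  "var f \<sigma> = (SUP \<gamma>\<in>Collect pl_curve. cvar f \<sigma> \<gamma> * ennreal (rho \<gamma>))"

definition bv_norm :: "complex set \<Rightarrow> (complex \<Rightarrow> complex) \<Rightarrow> ennreal" where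
  "bv_norm \<sigma> f = (SUP z\<in>\<sigma>. ennreal (cmod (f z))) + var f \<sigma>"

definition BV :: "complex set \<Rightarrow> (complex \<Rightarrow> complex) set" where
  "BV \<sigma> = {f. bv_norm \<sigma> f < \<infinity>}"

definition poly_z_cnj :: "(complex \<Rightarrow> complex) set" where
  "poly_z_cnj = {p. \<exists>(n::nat) (c::nat \<Rightarrow> nat \<Rightarrow> complex).
    p = (\<lambda>z. \<Sum>i\<le>n. \<Sum>j\<le>n. c i j * z ^ i * cnj z ^ j)}"

definition AC :: "complex set \<Rightarrow> (complex \<Rightarrow> complex) set" where
  "AC \<sigma> = {f\<in>BV \<sigma>. \<forall>\<epsilon>>0. \<exists>p\<in>poly_z_cnj. bv_norm \<sigma> (\<lambda>z. f z - p z) < ennreal \<epsilon>}"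

text \<open>Functions agreeing on \<open>\<sigma>\<close> are at \<open>bv_norm\<close> distance \<open>0\<close>, so the continuity clause also
  makes \<open>\<Psi> f\<close> depend only on the restriction of \<open>f\<close> to \<open>\<sigma>\<close>.\<close>

definition AC_functional_calculus ::
    "complex set \<Rightarrow> ((complex \<Rightarrow> complex) \<Rightarrow> ('a::complex_banach \<Rightarrow>\<^sub>L 'a)) \<Rightarrow> bool" where
  "AC_functional_calculus \<sigma> \<Psi> \<longleftrightarrow>
    (\<forall>f\<in>AC \<sigma>. \<Psi> f \<in> bounded_ops) \<and>
    (\<forall>f\<in>AC \<sigma>. \<forall>g\<in>AC \<sigma>. \<Psi> (\<lambda>z. f z + g z) = \<Psi> f + \<Psi> g) \<and>
    (\<forall>c. \<forall>f\<in>AC \<sigma>. \<Psi> (\<lambda>z. c * f z) = c *\<^sub>C \<Psi> f) \<and>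
    (\<forall>f\<in>AC \<sigma>. \<forall>g\<in>AC \<sigma>. \<Psi> (\<lambda>z. f z * g z) = \<Psi> f o\<^sub>L \<Psi> g) \<and>
    \<Psi> (\<lambda>z. 1) = id_blinfun \<and>
    (\<forall>f\<in>AC \<sigma>. \<forall>\<epsilon>>0. \<exists>\<delta>>0. \<forall>g\<in>AC \<sigma>.
      bv_norm \<sigma> (\<lambda>z. g z - f z) < ennreal \<delta> \<longrightarrow> norm (\<Psi> g - \<Psi> f) < \<epsilon>)"

definition AC_operator :: "complex set \<Rightarrow> ('a::complex_banach \<Rightarrow>\<^sub>L 'a) \<Rightarrow> bool" where
  "AC_operator \<sigma> T \<longleftrightarrow> T \<in> bounded_ops \<and>
    (\<exists>\<Psi>. AC_functional_calculus \<sigma> \<Psi> \<and> \<Psi> (\<lambda>z. z) = T)"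

end

theory Submission imports Defs begin

text \<open>Uniqueness holds for every compact \<open>T\<close> and all commuting well-bounded pairs. A well-bounded
  operator has a \<open>C\<^sup>1\<close> functional calculus on an interval. Let \<open>T = A + iB\<close> and
  \<open>\<lambda> = \<mu> + i\<nu> \<noteq> 0\<close>, and let \<open>Q n = f n(A) g n(B)\<close> with cutoff functions \<open>f n\<close>, \<open>g n\<close> that
  shrink to \<open>\<mu>\<close> and \<open>\<nu>\<close>. The \<open>Q n\<close> are approximate eigenprojections of \<open>T\<close>, and compactness forces
  the sequence to become constant; its final value \<open>P \<lambda>\<close> satisfies \<open>A P = \<mu> P\<close> and \<open>B P = \<nu> P\<close>. By a
  partition of unity, \<open>f(A)\<close> is a finite combination of these projections whenever \<open>f\<close> vanishes near
  \<open>0\<close>. If \<open>T = U + iV\<close> is a second splitting with projections \<open>P'\<close>, then \<open>P \<lambda> P' \<kappa> = 0\<close> for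
  \<open>\<lambda> \<noteq> \<kappa>\<close>, because \<open>P \<lambda> T P' \<kappa>\<close> is both \<open>\<lambda> P \<lambda> P' \<kappa>\<close> and \<open>\<kappa> P \<lambda> P' \<kappa>\<close>. As \<open>T\<close> lies in the
  closed span of either family, \<open>P \<lambda> = P' \<lambda>\<close>, whence \<open>f(A) = f(U)\<close> for all \<open>f\<close> vanishing near
  \<open>0\<close>, and \<open>A = U\<close> in the limit.

  For existence, let \<open>u\<close> be a real linear functional on the plane. For a polynomial \<open>p\<close> and a curve
  \<open>\<gamma>\<close>, the variation of \<open>p \<circ> u\<close> along \<open>\<gamma>\<close> is at most the integral of \<open>|p'(t)|\<close> times the number
  of entry points of \<open>\<gamma>\<close> on the line \<open>u = t\<close>, so \<open>p \<mapsto> p \<circ> u\<close> is bounded into \<open>AC(\<sigma>)\<close>. Hence the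
  functional calculus of \<open>T\<close> sends \<open>u\<close> to a well-bounded operator. By uniqueness \<open>A\<close> and \<open>B\<close> are the
  images of \<open>Re\<close> and \<open>Im\<close>, and real linear combinations of them are again images of such \<open>u\<close>.\<close>

section \<open>The continuously differentiable functional calculus\<close>

text \<open>The sort asks for a unit, but neither for \<open>1 \<noteq> 0\<close> nor for
  \<open>norm 1 = 1\<close>, so that the operators on the zero space are included.\<close>

definition peval :: "real poly \<Rightarrow> 'b::{real_normed_algebra, monoid_mult} \<Rightarrow> 'b" where
  "peval p a = (\<Sum>i\<le>degree p. coeff p i *\<^sub>R a ^ i)"

lemma peval_0 [simp]: "peval 0 a = 0"
  by (simp add: peval_def)

lemma peval_altdef:
  assumes "degree p \<le> n"
  shows "peval p a = (\<Sum>i\<le>n. coeff p i *\<^sub>R a ^ i)"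
  unfolding peval_def
  by (rule sum.mono_neutral_left) (use assms in \<open>auto simp: coeff_eq_0\<close>)

lemma peval_pCons [simp]: "peval (pCons c p) a = c *\<^sub>R 1 + a * peval p a"
proof -
  have "peval (pCons c p) a = (\<Sum>i\<le>Suc (degree p). coeff (pCons c p) i *\<^sub>R a ^ i)"
    by (rule peval_altdef) (rule degree_pCons_le)
  also have "\<dots> = c *\<^sub>R 1 + (\<Sum>i\<le>degree p. coeff p i *\<^sub>R (a * a ^ i))"
    by (simp only: sum.atMost_Suc_shift) simp
  also have "\<dots> = c *\<^sub>R 1 + a * peval p a"
    by (simp add: peval_def sum_distrib_left)
  finally show ?thesis .
qed

lemma peval_add: "peval (p + q) a = peval p a + peval q a"
  by (induction p q rule: poly_induct2) (simp_all add: algebra_simps)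

lemma peval_smult: "peval (smult c p) a = c *\<^sub>R peval p a"
  by (induction p) (simp_all add: algebra_simps)

lemma peval_diff: "peval (p - q) a = peval p a - peval q a"
  using peval_add[of "p - q" q a] by simp

lemma peval_mult: "peval (p * q) a = peval p a * peval q a"
  by (induction p) (simp_all add: algebra_simps peval_add peval_smult)

lemma peval_commute:
  assumes "x * a = a * x"
  shows "x * peval p a = peval p a * x"
proof (induction p)
  case (pCons c p)
  have "x * (a * peval p a) = a * (x * peval p a)"
    by (simp add: assms flip: mult.assoc)
  then show ?case using pCons by (simp add: algebra_simps)
qed simp

lemma peval_eigen:
  assumes "a * y = \<mu> *\<^sub>R y"
  shows "peval p a * y = poly p \<mu> *\<^sub>R y"
  by (induction p) (simp_all add: algebra_simps assms)

text \<open>The estimate of a well-bounded operator, for real polynomials on a symmetric interval.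
  \<open>R\<close> and \<open>C\<close> are parameters so that several operators can share
  them.\<close>

definition ac_bounded :: "real \<Rightarrow> real \<Rightarrow> 'b::{real_normed_algebra, monoid_mult} \<Rightarrow> bool" where
  "ac_bounded R C a \<longleftrightarrow> 0 < R \<and> 0 \<le> C \<and>
    (\<forall>p. norm (peval p a) \<le> C * (\<bar>poly p R\<bar> + integral {-R..R} (\<lambda>t. \<bar>poly (pderiv p) t\<bar>)))"

section \<open>Continuously differentiable functions on the line\<close>

definition C1 :: "(real \<Rightarrow> real) \<Rightarrow> bool" where
  "C1 f \<longleftrightarrow> (\<forall>x. (f has_real_derivative deriv f x) (at x)) \<and> continuous_on UNIV (deriv f)"

lemma C1I:
  assumes "\<And>x. (f has_real_derivative f' x) (at x)" and "continuous_on UNIV f'"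
  shows "C1 f" and "deriv f = f'"
proof -
  show "deriv f = f'"
    using assms(1) DERIV_imp_deriv by blast
  with assms show "C1 f" by (simp add: C1_def)
qed

lemma C1_DERIV: "C1 f \<Longrightarrow> (f has_real_derivative deriv f x) (at x)"
  by (simp add: C1_def)

lemma C1_continuous: "C1 f \<Longrightarrow> continuous_on S f"
  by (meson C1_def DERIV_isCont continuous_at_imp_continuous_on)

lemma C1_continuous_deriv: "C1 f \<Longrightarrow> continuous_on S (deriv f)"
  using C1_def continuous_on_subset by blast

lemma C1_poly: "C1 (poly p)" "deriv (poly p) = poly (pderiv p)"
  by (rule C1I[where f' = "poly (pderiv p)"]; simp add: poly_DERIV continuous_on_poly)+

lemma C1_const [simp]: "C1 (\<lambda>x. c)" "deriv (\<lambda>x. c::real) = (\<lambda>x::real. 0)"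
  by (rule C1I[where f' = "\<lambda>_. 0"]; simp)+

lemma C1_id [simp]: "C1 (\<lambda>x. x)"
  by (rule C1I[where f' = "\<lambda>_. 1"]) (auto intro!: derivative_eq_intros continuous_intros)

lemma C1_add:
  assumes "C1 f" "C1 g"
  shows "C1 (\<lambda>x. f x + g x)" "deriv (\<lambda>x. f x + g x) = (\<lambda>x. deriv f x + deriv g x)"
proof -
  have *: "((\<lambda>x. f x + g x) has_real_derivative deriv f x + deriv g x) (at x)" for x
    by (intro DERIV_add C1_DERIV assms)
  have "continuous_on UNIV (\<lambda>x. deriv f x + deriv g x)"
    by (intro continuous_on_add C1_continuous_deriv assms)
  from C1I[OF * this] show "C1 (\<lambda>x. f x + g x)"
    "deriv (\<lambda>x. f x + g x) = (\<lambda>x. deriv f x + deriv g x)" .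
qed

lemma C1_mult:
  assumes "C1 f" "C1 g"
  shows "C1 (\<lambda>x. f x * g x)" "deriv (\<lambda>x. f x * g x) = (\<lambda>x. deriv f x * g x + f x * deriv g x)"
proof -
  have *: "((\<lambda>x. f x * g x) has_real_derivative deriv f x * g x + f x * deriv g x) (at x)" for x
    by (rule DERIV_cong[OF DERIV_mult[OF C1_DERIV[OF assms(1)] C1_DERIV[OF assms(2)]]]) simp
  have "continuous_on UNIV (\<lambda>x. deriv f x * g x + f x * deriv g x)"
    by (intro continuous_on_add continuous_on_mult C1_continuous_deriv C1_continuous assms)
  from C1I[OF * this] show "C1 (\<lambda>x. f x * g x)"
    "deriv (\<lambda>x. f x * g x) = (\<lambda>x. deriv f x * g x + f x * deriv g x)" .
qed

lemma C1_cmult: "C1 f \<Longrightarrow> C1 (\<lambda>x. c * f x)" "C1 f \<Longrightarrow> deriv (\<lambda>x. c * f x) = (\<lambda>x. c * deriv f x)"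
  using C1_mult[OF C1_const(1), of f c] by auto

lemma C1_diff:
  assumes "C1 f" "C1 g"
  shows "C1 (\<lambda>x. f x - g x)"
  using C1_add(1)[OF assms(1) C1_cmult(1)[OF assms(2), of "-1"]] by simp

lemma C1_affine:
  assumes "C1 f"
  shows "C1 (\<lambda>x. f (c * x + d))" "deriv (\<lambda>x. f (c * x + d)) = (\<lambda>x. c * deriv f (c * x + d))"
proof -
  have *: "((\<lambda>x. f (c * x + d)) has_real_derivative c * deriv f (c * x + d)) (at x)" for x
    by (rule DERIV_cong[OF DERIV_chain2[OF C1_DERIV[OF assms]]])
      (auto intro!: derivative_eq_intros)
  have "continuous_on UNIV (\<lambda>x. c * deriv f (c * x + d))"
    by (intro continuous_intros continuous_on_compose2[OF C1_continuous_deriv[OF assms, of UNIV]])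
      auto
  from C1I[OF * this] show "C1 (\<lambda>x. f (c * x + d))"
    "deriv (\<lambda>x. f (c * x + d)) = (\<lambda>x. c * deriv f (c * x + d))" .
qed

section \<open>Simultaneous polynomial approximation of a function and its derivative\<close>

definition C1_lim :: "real \<Rightarrow> (nat \<Rightarrow> real poly) \<Rightarrow> (real \<Rightarrow> real) \<Rightarrow> bool" where
  "C1_lim R p f \<longleftrightarrow>
    uniform_limit {-R..R} (\<lambda>n. poly (p n)) f sequentially \<and>
    uniform_limit {-R..R} (\<lambda>n. poly (pderiv (p n))) (deriv f) sequentially"

lemma pderiv_sum: "pderiv (\<Sum>i\<le>(n::nat). f i) = (\<Sum>i\<le>n. pderiv (f i))"
  by (induction n) (simp_all add: pderiv_add)

lemma ex_antiderivative_poly: "\<exists>p :: real poly. pderiv p = q"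
proof
  have "pderiv (\<Sum>i\<le>degree q. monom (coeff q i / real (Suc i)) (Suc i)) =
      (\<Sum>i\<le>degree q. monom (coeff q i) i)"
    by (simp add: pderiv_sum pderiv_monom del: of_nat_Suc)
  then show "pderiv (\<Sum>i\<le>degree q. monom (coeff q i / real (Suc i)) (Suc i)) = q"
    by (simp add: poly_as_sum_of_monoms)
qed

text \<open>The derivative is approximated by Weierstrass and then integrated. With equal values at
  \<open>-R\<close>, the error of the function is at most the error of the derivative times
  \<open>2 * R\<close>.\<close>

lemma C1_approx:
  assumes f: "C1 f" and R: "0 < R" and e: "0 < e"
  shows "\<exists>p. \<forall>x\<in>{-R..R}. \<bar>poly p x - f x\<bar> < e \<and> \<bar>poly (pderiv p) x - deriv f x\<bar> < e"
proof -
  define d where "d = e / (1 + 2 * R)"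
  have d: "0 < d" "d \<le> e" "2 * R * d < e"
    using R e by (auto simp: d_def field_simps)
  obtain g where g: "real_polynomial_function g" "\<And>x. x \<in> {-R..R} \<Longrightarrow> \<bar>deriv f x - g x\<bar> < d"
    using Stone_Weierstrass_real_polynomial_function[of "{-R..R}" "deriv f" d]
      C1_continuous_deriv[OF f] d by auto
  obtain a n where "g = (\<lambda>x. \<Sum>i\<le>n. a i * x ^ i)"
    using g(1) by (auto simp: real_polynomial_function_iff_sum)
  then have "g = poly (\<Sum>i\<le>n. monom (a i) i)"
    by (auto simp: poly_sum poly_monom)
  then obtain q where q: "g = poly q" by blast
  obtain p0 where p0: "pderiv p0 = q" using ex_antiderivative_poly by blast
  define p where "p = p0 + [:f (-R) - poly p0 (-R):]"
  have p: "pderiv p = q" "poly p (-R) = f (-R)"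
    by (auto simp: p_def p0 pderiv_add pderiv_pCons)
  have "\<bar>poly p x - f x\<bar> < e" if x: "x \<in> {-R..R}" for x
  proof -
    have "norm ((poly p x - f x) - (poly p (-R) - f (-R))) \<le> d * norm (x - (-R))"
    proof (rule field_differentiable_bound[where S = "{-R..R}"])
      fix z assume z: "z \<in> {-R..R}"
      show "((\<lambda>x. poly p x - f x) has_field_derivative poly q z - deriv f z) (at z within {-R..R})"
        using p C1_DERIV[OF f] poly_DERIV[of p]
        by (metis DERIV_diff has_field_derivative_at_within)
      show "norm (poly q z - deriv f z) \<le> d"
        using g(2)[OF z] q by auto
    qed (use x R in auto)
    also have "\<dots> \<le> d * (2 * R)"
      using x d by (intro mult_left_mono) auto
    finally show ?thesis using d p by (auto simp: mult.commute)
  qed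
  moreover have "\<bar>poly (pderiv p) x - deriv f x\<bar> < e" if "x \<in> {-R..R}" for x
    using g(2)[OF that] d p q by auto
  ultimately show ?thesis by blast
qed

definition c1_approx :: "real \<Rightarrow> (real \<Rightarrow> real) \<Rightarrow> nat \<Rightarrow> real poly" where
  "c1_approx R f n = (SOME p. \<forall>x\<in>{-R..R}. \<bar>poly p x - f x\<bar> < inverse (real (Suc n)) \<and>
     \<bar>poly (pderiv p) x - deriv f x\<bar> < inverse (real (Suc n)))"

lemma C1_lim_approx:
  assumes "C1 f" "0 < R"
  shows "C1_lim R (c1_approx R f) f"
proof -
  have *: "\<forall>x\<in>{-R..R}. \<bar>poly (c1_approx R f n) x - f x\<bar> < inverse (real (Suc n)) \<and>
     \<bar>poly (pderiv (c1_approx R f n)) x - deriv f x\<bar> < inverse (real (Suc n))" for n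
    unfolding c1_approx_def by (rule someI_ex) (rule C1_approx, use assms in auto)
  have ev: "\<forall>\<^sub>F n in sequentially. inverse (real (Suc n)) < e" if "e > 0" for e
    using that LIMSEQ_inverse_real_of_nat by (rule order_tendstoD(2)[rotated])
  show ?thesis
    unfolding C1_lim_def uniform_limit_iff dist_real_def
    by (intro conjI allI impI; drule ev; elim eventually_mono) (use * less_trans in blast)+
qed

lemma C1_lim_poly: "C1_lim R (\<lambda>n. p) (poly p)"
  by (simp add: C1_lim_def C1_poly uniform_limit_const)

lemma C1_lim_add:
  assumes "C1 f" "C1 g" "C1_lim R p f" "C1_lim R q g"
  shows "C1_lim R (\<lambda>n. p n + q n) (\<lambda>x. f x + g x)"
  using assms(3,4) unfolding C1_lim_def C1_add(2)[OF assms(1,2)] pderiv_add poly_add[abs_def]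
  by (intro conjI uniform_limit_add) auto

lemma C1_lim_mult:
  assumes "C1 f" "C1 g" "C1_lim R p f" "C1_lim R q g"
  shows "C1_lim R (\<lambda>n. p n * q n) (\<lambda>x. f x * g x)"
proof -
  have b: "bounded (h ` {-R..R})" if "continuous_on {-R..R} h" for h :: "real \<Rightarrow> real"
    using that compact_continuous_image compact_imp_bounded by blast
  note bs = b[OF C1_continuous[OF assms(1)]] b[OF C1_continuous[OF assms(2)]]
    b[OF C1_continuous_deriv[OF assms(1)]] b[OF C1_continuous_deriv[OF assms(2)]]
  have "uniform_limit {-R..R} (\<lambda>n x. poly (p n) x * poly (pderiv (q n)) x +
      poly (q n) x * poly (pderiv (p n)) x) (\<lambda>x. f x * deriv g x + g x * deriv f x) sequentially"
    using assms(3,4) bs unfolding C1_lim_def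
    by (intro uniform_limit_add uniform_lim_mult) auto
  moreover have "uniform_limit {-R..R} (\<lambda>n x. poly (p n) x * poly (q n) x) (\<lambda>x. f x * g x) sequentially"
    using assms(3,4) bs unfolding C1_lim_def by (intro uniform_lim_mult) auto
  ultimately show ?thesis
    unfolding C1_lim_def C1_mult(2)[OF assms(1,2)]
    by (simp add: pderiv_mult poly_add[abs_def] poly_mult[abs_def] algebra_simps)
qed

section \<open>The calculus as a limit of polynomials\<close>

definition fcalc :: "real \<Rightarrow> 'b::{real_normed_algebra, monoid_mult, banach} \<Rightarrow> (real \<Rightarrow> real) \<Rightarrow> 'b" where
  "fcalc R a f = lim (\<lambda>n. peval (c1_approx R f n) a)"

text \<open>The norm in \<open>ac_bounded\<close> is one value plus an integral over an interval of
  length \<open>2 * R\<close>, hence at most \<open>1 + 2 * R\<close> times the \<open>C1\<close>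
  norm.\<close>

lemma peval_bound:
  assumes "ac_bounded R C a"
    and "\<And>x. x \<in> {-R..R} \<Longrightarrow> \<bar>poly p x\<bar> \<le> e \<and> \<bar>poly (pderiv p) x\<bar> \<le> e"
  shows "norm (peval p a) \<le> C * (1 + 2 * R) * e"
proof -
  have R: "0 < R" "0 \<le> C" using assms(1) by (auto simp: ac_bounded_def)
  have "integral {-R..R} (\<lambda>t. \<bar>poly (pderiv p) t\<bar>) \<le> integral {-R..R} (\<lambda>t. e)"
    using assms(2) by (intro integral_le integrable_continuous_interval continuous_intros) auto
  then have "\<bar>poly p R\<bar> + integral {-R..R} (\<lambda>t. \<bar>poly (pderiv p) t\<bar>) \<le> (1 + 2 * R) * e"
    using assms(2)[of R] R by (auto simp: algebra_simps)
  then have "C * (\<bar>poly p R\<bar> + integral {-R..R} (\<lambda>t. \<bar>poly (pderiv p) t\<bar>)) \<le> C * ((1 + 2 * R) * e)"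
    using R by (intro mult_left_mono) auto
  then show ?thesis using assms(1) by (auto simp: ac_bounded_def mult.assoc intro: order_trans)
qed

lemma uniform_limit_diff_small:
  fixes f g :: "nat \<Rightarrow> real \<Rightarrow> real"
  assumes "uniform_limit S f l sequentially" "uniform_limit S g l sequentially" "0 < e"
  obtains N where "\<And>m n x. m \<ge> N \<Longrightarrow> n \<ge> N \<Longrightarrow> x \<in> S \<Longrightarrow> \<bar>f m x - g n x\<bar> < e"
proof -
  have e: "0 < e / 2" using assms by simp
  obtain N1 where N1: "\<And>n x. n \<ge> N1 \<Longrightarrow> x \<in> S \<Longrightarrow> dist (f n x) (l x) < e / 2"
    using uniform_limitD[OF assms(1) e] by (auto simp: eventually_sequentially)
  obtain N2 where N2: "\<And>n x. n \<ge> N2 \<Longrightarrow> x \<in> S \<Longrightarrow> dist (g n x) (l x) < e / 2"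
    using uniform_limitD[OF assms(2) e] by (auto simp: eventually_sequentially)
  show thesis
  proof (rule that[of "max N1 N2"])
    fix m n x assume "m \<ge> max N1 N2" "n \<ge> max N1 N2" "x \<in> S"
    then show "\<bar>f m x - g n x\<bar> < e"
      using N1[of m x] N2[of n x] unfolding dist_real_def by (simp add: abs_if split: if_splits)
  qed
qed

text \<open>Two sequences are compared at once: \<open>q = p\<close> gives the Cauchy property, and
  different sequences with the same limit function show that the limit does not depend on the
  choice.\<close>

lemma peval_diff_small:
  assumes a: "ac_bounded R C a" and p: "C1_lim R p f" and q: "C1_lim R q f" and e: "0 < e"
  shows "\<exists>N. \<forall>m\<ge>N. \<forall>n\<ge>N. norm (peval (p m) a - peval (q n) a) < e"
proof -
  define K where "K = C * (1 + 2 * R)"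
  have K: "0 \<le> K" using a by (auto simp: K_def ac_bounded_def)
  define d where "d = e / (K + 1)"
  have d: "0 < d" "K * d < e" using K e by (auto simp: d_def field_simps)
  obtain N1 where N1: "\<And>m n x. m \<ge> N1 \<Longrightarrow> n \<ge> N1 \<Longrightarrow> x \<in> {-R..R} \<Longrightarrow>
      \<bar>poly (p m) x - poly (q n) x\<bar> < d"
    using uniform_limit_diff_small[OF _ _ d(1)] p q unfolding C1_lim_def by metis
  obtain N2 where N2: "\<And>m n x. m \<ge> N2 \<Longrightarrow> n \<ge> N2 \<Longrightarrow> x \<in> {-R..R} \<Longrightarrow>
      \<bar>poly (pderiv (p m)) x - poly (pderiv (q n)) x\<bar> < d"
    using uniform_limit_diff_small[OF _ _ d(1)] p q unfolding C1_lim_def by metis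
  have "norm (peval (p m) a - peval (q n) a) < e" if "m \<ge> max N1 N2" "n \<ge> max N1 N2" for m n
  proof -
    have "norm (peval (p m - q n) a) \<le> C * (1 + 2 * R) * d"
      using N1[of m n] N2[of m n] that
      by (intro peval_bound[OF a]) (auto simp: pderiv_diff intro: less_imp_le)
    with d show ?thesis by (simp add: peval_diff K_def)
  qed
  then show ?thesis by blast
qed

lemma fcalc_tendsto:
  assumes a: "ac_bounded R C a" and f: "C1 f" and p: "C1_lim R p f"
  shows "(\<lambda>n. peval (p n) a) \<longlonglongrightarrow> fcalc R a f"
proof -
  have R: "0 < R" using a by (simp add: ac_bounded_def)
  let ?q = "c1_approx R f"
  have q: "C1_lim R ?q f" using C1_lim_approx[OF f R] .
  have "Cauchy (\<lambda>n. peval (?q n) a)"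
    using peval_diff_small[OF a q q] by (intro CauchyI) blast
  then have l: "(\<lambda>n. peval (?q n) a) \<longlonglongrightarrow> fcalc R a f"
    unfolding fcalc_def using Cauchy_convergent convergent_LIMSEQ_iff by blast
  have "(\<lambda>n. peval (p n) a - peval (?q n) a) \<longlonglongrightarrow> 0"
    using peval_diff_small[OF a p q] by (intro LIMSEQ_I) fastforce
  from tendsto_add[OF this l] show ?thesis by simp
qed

lemma fcalc_poly:
  assumes "ac_bounded R C a"
  shows "fcalc R a (poly p) = peval p a"
  using fcalc_tendsto[OF assms C1_poly(1) C1_lim_poly] LIMSEQ_const_iff by metis

lemma fcalc_id: "ac_bounded R C a \<Longrightarrow> fcalc R a (\<lambda>x. x) = a"
  using fcalc_poly[of R C a "[:0, 1:]"] by (simp add: poly_pCons[abs_def])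

lemma fcalc_const: "ac_bounded R C a \<Longrightarrow> fcalc R a (\<lambda>x. c) = c *\<^sub>R 1"
  using fcalc_poly[of R C a "[:c:]"] by (simp add: poly_pCons[abs_def])

lemma fcalc_add:
  assumes "ac_bounded R C a" "C1 f" "C1 g"
  shows "fcalc R a (\<lambda>x. f x + g x) = fcalc R a f + fcalc R a g"
proof -
  have R: "0 < R" using assms by (simp add: ac_bounded_def)
  note l = C1_lim_approx[OF assms(2) R] C1_lim_approx[OF assms(3) R]
  have "(\<lambda>n. peval (c1_approx R f n) a + peval (c1_approx R g n) a) \<longlonglongrightarrow> fcalc R a (\<lambda>x. f x + g x)"
    using fcalc_tendsto[OF assms(1) C1_add(1)[OF assms(2,3)] C1_lim_add[OF assms(2,3) l]]
    by (simp add: peval_add)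
  with tendsto_add[OF fcalc_tendsto[OF assms(1,2) l(1)] fcalc_tendsto[OF assms(1,3) l(2)]]
  show ?thesis using LIMSEQ_unique by blast
qed

lemma fcalc_mult:
  assumes "ac_bounded R C a" "C1 f" "C1 g"
  shows "fcalc R a (\<lambda>x. f x * g x) = fcalc R a f * fcalc R a g"
proof -
  have R: "0 < R" using assms by (simp add: ac_bounded_def)
  note l = C1_lim_approx[OF assms(2) R] C1_lim_approx[OF assms(3) R]
  have "(\<lambda>n. peval (c1_approx R f n) a * peval (c1_approx R g n) a) \<longlonglongrightarrow> fcalc R a (\<lambda>x. f x * g x)"
    using fcalc_tendsto[OF assms(1) C1_mult(1)[OF assms(2,3)] C1_lim_mult[OF assms(2,3) l]]
    by (simp add: peval_mult)
  with tendsto_mult[OF fcalc_tendsto[OF assms(1,2) l(1)] fcalc_tendsto[OF assms(1,3) l(2)]]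
  show ?thesis using LIMSEQ_unique by blast
qed

lemma fcalc_cmult:
  assumes "ac_bounded R C a" "C1 f"
  shows "fcalc R a (\<lambda>x. c * f x) = c *\<^sub>R fcalc R a f"
  using fcalc_mult[OF assms(1) C1_const(1) assms(2)] fcalc_const[OF assms(1)] by simp

lemma fcalc_diff:
  assumes "ac_bounded R C a" "C1 f" "C1 g"
  shows "fcalc R a (\<lambda>x. f x - g x) = fcalc R a f - fcalc R a g"
  using fcalc_add[OF assms(1,2) C1_cmult(1)[OF assms(3), of "-1"]] fcalc_cmult[OF assms(1,3), of "-1"]
  by simp

lemma fcalc_sum:
  assumes "ac_bounded R C a" "\<And>i. C1 (f i)"
  shows "C1 (\<lambda>x. \<Sum>i<(k::nat). f i x)" "fcalc R a (\<lambda>x. \<Sum>i<k. f i x) = (\<Sum>i<k. fcalc R a (f i))"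
proof (induction k)
  case 0
  show "C1 (\<lambda>x. \<Sum>i<0. f i x)" "fcalc R a (\<lambda>x. \<Sum>i<0. f i x) = (\<Sum>i<0. fcalc R a (f i))"
    using fcalc_const[OF assms(1), of 0] by simp_all
next
  case (Suc k)
  then show "C1 (\<lambda>x. \<Sum>i<Suc k. f i x)"
    "fcalc R a (\<lambda>x. \<Sum>i<Suc k. f i x) = (\<Sum>i<Suc k. fcalc R a (f i))"
    by (simp_all add: C1_add assms fcalc_add[OF assms(1)])
qed

lemma fcalc_commute:
  assumes "ac_bounded R C a" "C1 f" "x * a = a * x"
  shows "x * fcalc R a f = fcalc R a f * x"
proof -
  have R: "0 < R" using assms by (simp add: ac_bounded_def)
  note l = fcalc_tendsto[OF assms(1,2) C1_lim_approx[OF assms(2) R]]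
  have "(\<lambda>n. x * peval (c1_approx R f n) a) \<longlonglongrightarrow> x * fcalc R a f"
    by (intro tendsto_intros l)
  moreover have "(\<lambda>n. x * peval (c1_approx R f n) a) \<longlonglongrightarrow> fcalc R a f * x"
    unfolding peval_commute[OF assms(3)] by (intro tendsto_intros l)
  ultimately show ?thesis using LIMSEQ_unique by blast
qed

text \<open>Here \<open>y\<close> is an element of the algebra, later a projection. The approximants
  converge only on \<open>{-R..R}\<close>, hence the condition on \<open>\<mu>\<close>.\<close>

lemma fcalc_eigen:
  assumes "ac_bounded R C a" "C1 f" "a * y = \<mu> *\<^sub>R y" "\<mu> \<in> {-R..R}"
  shows "fcalc R a f * y = f \<mu> *\<^sub>R y"
proof -
  have R: "0 < R" using assms by (simp add: ac_bounded_def)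
  note L = C1_lim_approx[OF assms(2) R]
  note l = fcalc_tendsto[OF assms(1,2) L]
  have "(\<lambda>n. poly (c1_approx R f n) \<mu>) \<longlonglongrightarrow> f \<mu>"
    using L assms(4) unfolding C1_lim_def
    by (intro tendsto_uniform_limitI[where S = "{-R..R}"]) auto
  then have "(\<lambda>n. poly (c1_approx R f n) \<mu> *\<^sub>R y) \<longlonglongrightarrow> f \<mu> *\<^sub>R y"
    by (intro tendsto_intros)
  moreover have "(\<lambda>n. peval (c1_approx R f n) a * y) \<longlonglongrightarrow> fcalc R a f * y"
    by (intro tendsto_intros l)
  ultimately show ?thesis
    unfolding peval_eigen[OF assms(3)] using LIMSEQ_unique by blast
qed

text \<open>The bound by total variation survives the limit. Unlike a bound by the \<open>C1\<close>
  norm, it stays uniform for cutoffs of ever steeper slope.\<close>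

lemma norm_fcalc_le:
  assumes "ac_bounded R C a" "C1 f"
  shows "norm (fcalc R a f) \<le> C * (\<bar>f R\<bar> + integral {-R..R} (\<lambda>t. \<bar>deriv f t\<bar>))"
proof -
  have R: "0 < R" using assms by (simp add: ac_bounded_def)
  let ?p = "c1_approx R f"
  note L = C1_lim_approx[OF assms(2) R]
  have 1: "(\<lambda>n. norm (peval (?p n) a)) \<longlonglongrightarrow> norm (fcalc R a f)"
    by (intro tendsto_intros fcalc_tendsto[OF assms L])
  have 2: "(\<lambda>n. poly (?p n) R) \<longlonglongrightarrow> f R"
    using L R unfolding C1_lim_def by (intro tendsto_uniform_limitI[where S = "{-R..R}"]) auto
  have "uniform_limit {-R..R} (\<lambda>n x. norm (poly (pderiv (?p n)) x)) (\<lambda>x. norm (deriv f x)) sequentially"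
    using L unfolding C1_lim_def by (intro uniform_limit_norm) auto
  then have u: "uniform_limit {-R..R} (\<lambda>n x. \<bar>poly (pderiv (?p n)) x\<bar>) (\<lambda>x. \<bar>deriv f x\<bar>) sequentially"
    by simp
  have c: "continuous_on {-R..R} (\<lambda>x. \<bar>poly (pderiv (?p n)) x\<bar>)" for n
    by (intro continuous_intros)
  obtain I J
    where I: "\<And>n. ((\<lambda>x. \<bar>poly (pderiv (?p n)) x\<bar>) has_integral I n) {-R..R}"
      and J: "((\<lambda>x. \<bar>deriv f x\<bar>) has_integral J) {-R..R}" and IJ: "I \<longlonglongrightarrow> J"
    by (rule uniform_limit_integral[OF u c trivial_limit_sequentially]) (rule that)
  have "integral {-R..R} (\<lambda>t. \<bar>poly (pderiv (?p n)) t\<bar>) = I n" for n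
    using I by (rule integral_unique)
  then have 3: "(\<lambda>n. integral {-R..R} (\<lambda>t. \<bar>poly (pderiv (?p n)) t\<bar>)) \<longlonglongrightarrow> integral {-R..R} (\<lambda>t. \<bar>deriv f t\<bar>)"
    using IJ integral_unique[OF J] by simp
  have 4: "(\<lambda>n. C * (\<bar>poly (?p n) R\<bar> + integral {-R..R} (\<lambda>t. \<bar>poly (pderiv (?p n)) t\<bar>)))
     \<longlonglongrightarrow> C * (\<bar>f R\<bar> + integral {-R..R} (\<lambda>t. \<bar>deriv f t\<bar>))"
    by (intro tendsto_intros 2 3)
  show ?thesis
    by (rule LIMSEQ_le[OF 1 4]) (use assms(1) in \<open>auto simp: ac_bounded_def\<close>)
qed

lemma fcalc_zero_on:
  assumes "ac_bounded R C a" "C1 f" "\<And>x. x \<in> {-R..R} \<Longrightarrow> f x = 0"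
  shows "fcalc R a f = 0"
proof -
  have R: "0 < R" using assms by (simp add: ac_bounded_def)
  \<comment> \<open>The open interval suffices, since the two endpoints do not affect the
    integral.\<close>
  have "deriv f x = 0" if "x \<in> {-R<..<R}" for x
  proof -
    have "(f has_real_derivative 0) (at x)"
      by (rule has_field_derivative_transform_within_open[of "\<lambda>_. 0" _ _ "{-R<..<R}"])
        (use that assms(3) in auto)
    then show ?thesis by (rule DERIV_imp_deriv)
  qed
  then have "((\<lambda>t. \<bar>deriv f t\<bar>) has_integral 0) {-R..R}"
    by (intro has_integral_spike_finite[OF _ _ has_integral_0, of "{-R, R}"]) auto
  from integral_unique[OF this] have "norm (fcalc R a f) \<le> 0"
    using norm_fcalc_le[OF assms(1,2)] assms(3)[of R] R by simp
  then show ?thesis by simp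
qed

lemma fcalc_cong_on:
  assumes "ac_bounded R C a" "C1 f" "C1 g" "\<And>x. x \<in> {-R..R} \<Longrightarrow> f x = g x"
  shows "fcalc R a f = fcalc R a g"
  using fcalc_zero_on[OF assms(1) C1_diff[OF assms(2,3)]] fcalc_diff[OF assms(1-3)] assms(4)
  by simp

text \<open>The derivative lives on an interval of length \<open>2 * h\<close> around
  \<open>\<mu>\<close>, so the variation is at most \<open>2 * h * L\<close>.\<close>

lemma norm_fcalc_local_le:
  assumes "ac_bounded R C a" "C1 f" "\<bar>f R\<bar> \<le> K" "0 \<le> h" "0 \<le> L"
    and "\<And>x. \<bar>deriv f x\<bar> \<le> L" "\<And>x. \<bar>x - \<mu>\<bar> > h \<Longrightarrow> deriv f x = 0"
  shows "norm (fcalc R a f) \<le> C * (K + 2 * h * L)"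
proof -
  have C: "0 \<le> C" using assms by (simp add: ac_bounded_def)
  let ?g = "\<lambda>t. if t \<in> {\<mu>-h..\<mu>+h} then L else 0"
  have Int: "{-R..R} \<inter> {\<mu>-h..\<mu>+h} = {max (-R) (\<mu>-h)..min R (\<mu>+h)}"
    by (rule Int_atLeastAtMost)
  have "integral {-R..R} (\<lambda>t. \<bar>deriv f t\<bar>) \<le> integral {-R..R} ?g"
  proof (rule integral_le)
    show "(\<lambda>t. \<bar>deriv f t\<bar>) integrable_on {-R..R}"
      by (intro integrable_continuous_interval continuous_intros C1_continuous_deriv assms)
    show "?g integrable_on {-R..R}"
      by (simp only: integrable_restrict_Int Int Int_commute[of "{\<mu>-h..\<mu>+h}"] integrable_const_ivl)
    show "\<bar>deriv f x\<bar> \<le> ?g x" for x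
      using assms(6)[of x] assms(7)[of x] by (cases "h < \<bar>x - \<mu>\<bar>") auto
  qed
  also have "\<dots> = integral {max (-R) (\<mu>-h)..min R (\<mu>+h)} (\<lambda>t. L)"
    by (simp only: integral_restrict_Int Int Int_commute[of "{\<mu>-h..\<mu>+h}"])
  also have "\<dots> \<le> 2 * h * L"
    using assms(4,5) by (auto intro!: mult_right_mono simp: content_real_if)
  finally have "C * (\<bar>f R\<bar> + integral {-R..R} (\<lambda>t. \<bar>deriv f t\<bar>)) \<le> C * (K + 2 * h * L)"
    using assms(3) C by (intro mult_left_mono) auto
  with norm_fcalc_le[OF assms(1,2)] show ?thesis by linarith
qed

section \<open>Cutoff functions\<close>

lemma max0_square_DERIV: "((\<lambda>t::real. (max 0 t)\<^sup>2) has_real_derivative 2 * max 0 x) (at x)"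
proof -
  consider "x < 0" | "x = 0" | "x > 0" by linarith
  then show ?thesis
  proof cases
    case 1
    have "((\<lambda>t::real. (max 0 t)\<^sup>2) has_real_derivative 0) (at x)"
      by (rule has_field_derivative_transform_within_open[OF DERIV_const, of "{..<0}"])
        (use 1 in auto)
    then show ?thesis using 1 by simp
  next
    case 2
    have "((\<lambda>h::real. (max 0 h)\<^sup>2 / h) \<longlongrightarrow> 0) (at 0)"
    proof (rule Lim_null_comparison)
      show "\<forall>\<^sub>F h in at 0. norm ((max 0 h)\<^sup>2 / h) \<le> \<bar>h\<bar>"
        by (intro always_eventually) (auto simp: max_def power2_eq_square)
      show "((\<lambda>h::real. \<bar>h\<bar>) \<longlongrightarrow> 0) (at 0)"
        by (auto intro!: tendsto_eq_intros)
    qed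
    then show ?thesis using 2 by (simp add: has_field_derivative_iff)
  next
    case 3
    have "((\<lambda>t::real. t\<^sup>2) has_real_derivative 2 * x) (at x)"
      by (auto intro!: derivative_eq_intros)
    then have "((\<lambda>t::real. (max 0 t)\<^sup>2) has_real_derivative 2 * x) (at x)"
      by (rule has_field_derivative_transform_within_open[where S = "{0<..}"]) (use 3 in auto)
    then show ?thesis using 3 by simp
  qed
qed

text \<open>A quadratic spline rising from \<open>0\<close> on \<open>(-\<infinity>, 0]\<close> to \<open>1\<close> on \<open>[1, \<infinity>)\<close>.\<close>

definition step :: "real \<Rightarrow> real" where
  "step t = 2 * (max 0 t)\<^sup>2 - 4 * (max 0 (t - 1 / 2))\<^sup>2 + 2 * (max 0 (t - 1))\<^sup>2"

definition step' :: "real \<Rightarrow> real" where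
  "step' t = 4 * max 0 t - 8 * max 0 (t - 1 / 2) + 4 * max 0 (t - 1)"

lemma C1_step: "C1 step" "deriv step = step'"
proof -
  have *: "((\<lambda>t. (max 0 (t - c))\<^sup>2) has_real_derivative 2 * max 0 (x - c)) (at x)" for c x :: real
    by (rule DERIV_cong[OF DERIV_chain2[OF max0_square_DERIV]]) (auto intro!: derivative_eq_intros)
  have "(step has_real_derivative step' x) (at x)" for x
    unfolding step_def[abs_def] step'_def
    by (rule DERIV_cong[OF DERIV_add[OF DERIV_diff[OF DERIV_cmult[OF max0_square_DERIV]
      DERIV_cmult[OF *]] DERIV_cmult[OF *]]]) simp
  moreover have "continuous_on UNIV step'"
    unfolding step'_def[abs_def] by (intro continuous_intros)
  ultimately show "C1 step" "deriv step = step'"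
    by (rule C1I)+
qed

lemma step_simps: "t \<le> 0 \<Longrightarrow> step t = 0" "1 \<le> t \<Longrightarrow> step t = 1"
  "t \<le> 0 \<Longrightarrow> step' t = 0" "1 \<le> t \<Longrightarrow> step' t = 0"
  by (auto simp: step_def step'_def power2_eq_square algebra_simps)

lemma step_bounds: "0 \<le> step t" "step t \<le> 1" "\<bar>step' t\<bar> \<le> 2"
proof -
  have *: "0 \<le> step t \<and> step t \<le> 1"
  proof (cases "0 < t \<and> t < 1")
    case True
    show ?thesis
    proof (cases "t \<le> 1 / 2")
      case t: True
      have "t\<^sup>2 \<le> (1 / 2)\<^sup>2" using True t by (intro power_mono) auto
      then show ?thesis using True t by (simp add: step_def power_divide)
    next
      case False
      have "(1 - t)\<^sup>2 \<le> (1 / 2)\<^sup>2" using True False by (intro power_mono) auto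
      moreover have "step t = 1 - 2 * (1 - t)\<^sup>2"
        using True False by (simp add: step_def power2_eq_square algebra_simps)
      ultimately show ?thesis by (simp add: power_divide)
    qed
  qed (use step_simps[of t] in auto)
  then show "0 \<le> step t" "step t \<le> 1" by auto
  show "\<bar>step' t\<bar> \<le> 2"
    by (auto simp: step'_def max_def)
qed

text \<open>For \<open>h > 0\<close> this is a plateau: \<open>1\<close> for
  \<open>\<bar>x - \<mu>\<bar> \<le> h\<close> and \<open>0\<close> for
  \<open>\<bar>x - \<mu>\<bar> \<ge> 2 * h\<close>, with a scaled copy of \<open>step\<close> as
  each flank.\<close>

definition cutoff :: "real \<Rightarrow> real \<Rightarrow> real \<Rightarrow> real" where
  "cutoff \<mu> h x = step ((x - \<mu>) / h + 2) - step ((x - \<mu>) / h - 1)"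

definition cutoff' :: "real \<Rightarrow> real \<Rightarrow> real \<Rightarrow> real" where
  "cutoff' \<mu> h x = (step' ((x - \<mu>) / h + 2) - step' ((x - \<mu>) / h - 1)) / h"

lemma C1_cutoff: "C1 (cutoff \<mu> h)" "deriv (cutoff \<mu> h) = cutoff' \<mu> h"
proof -
  have e: "(x - \<mu>) / h + c = (1 / h) * x + (c - \<mu> / h)" for x c
    by (simp add: diff_divide_distrib)
  have *: "C1 (\<lambda>x. step ((x - \<mu>) / h + c))"
    "deriv (\<lambda>x. step ((x - \<mu>) / h + c)) = (\<lambda>x. step' ((x - \<mu>) / h + c) / h)" for c
    using C1_affine[OF C1_step(1), of "1 / h" "c - \<mu> / h"] unfolding e C1_step(2) by simp_all
  note a = *[of 2] and b = *[of "-1"]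
  have eq: "cutoff \<mu> h = (\<lambda>x. step ((x - \<mu>) / h + 2) + (-1) * step ((x - \<mu>) / h + (-1)))"
    by (auto simp: cutoff_def)
  show "C1 (cutoff \<mu> h)" unfolding eq
    by (intro C1_add(1) C1_cmult(1) a b)
  have "deriv (cutoff \<mu> h) = (\<lambda>x. deriv (\<lambda>x. step ((x - \<mu>) / h + 2)) x +
      (-1) * deriv (\<lambda>x. step ((x - \<mu>) / h + (-1))) x)"
    unfolding eq by (subst C1_add(2)[OF a(1) C1_cmult(1)[OF b(1)]], subst C1_cmult(2)[OF b(1)]) (rule refl)
  then show "deriv (cutoff \<mu> h) = cutoff' \<mu> h"
    unfolding a(2) b(2) by (auto simp: cutoff'_def diff_divide_distrib)
qed

lemma cutoff_eq_1: "0 < h \<Longrightarrow> \<bar>x - \<mu>\<bar> \<le> h \<Longrightarrow> cutoff \<mu> h x = 1"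
  unfolding cutoff_def by (subst step_simps(2), simp add: field_simps abs_le_iff)
    (subst step_simps(1), simp_all add: field_simps abs_le_iff)

lemma cutoff_outside:
  assumes "0 < h" "2 * h \<le> \<bar>x - \<mu>\<bar>"
  shows "cutoff \<mu> h x = 0" "cutoff' \<mu> h x = 0"
proof -
  consider "(x - \<mu>) / h \<ge> 2" | "(x - \<mu>) / h \<le> -2"
    using assms by (force simp: field_simps abs_if split: if_splits)
  then show "cutoff \<mu> h x = 0" "cutoff' \<mu> h x = 0"
    by (cases; simp add: cutoff_def cutoff'_def step_simps)+
qed

text \<open>The factor 2 puts the support of the narrower cutoff inside the plateau of the wider
  one.\<close>

lemma cutoff_mult:
  assumes "0 < h'" "2 * h' \<le> h"
  shows "cutoff \<mu> h x * cutoff \<mu> h' x = cutoff \<mu> h' x"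
  using cutoff_eq_1[of h x \<mu>] cutoff_outside(1)[of h' x \<mu>] assms
  by (cases "\<bar>x - \<mu>\<bar> \<le> h") auto

lemma cutoff_bounds: "\<bar>cutoff \<mu> h x\<bar> \<le> 1" "0 < h \<Longrightarrow> \<bar>cutoff' \<mu> h x\<bar> \<le> 4 / h"
proof -
  show "\<bar>cutoff \<mu> h x\<bar> \<le> 1"
    unfolding cutoff_def using step_bounds(1,2)[of "(x - \<mu>) / h + 2"]
      step_bounds(1,2)[of "(x - \<mu>) / h - 1"] by linarith
  have "\<bar>step' ((x - \<mu>) / h + 2) - step' ((x - \<mu>) / h - 1)\<bar> \<le> 4"
    using step_bounds(3)[of "(x - \<mu>) / h + 2"] step_bounds(3)[of "(x - \<mu>) / h - 1"] by linarith
  then show "0 < h \<Longrightarrow> \<bar>cutoff' \<mu> h x\<bar> \<le> 4 / h"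
    by (simp add: cutoff'_def abs_divide divide_right_mono)
qed

text \<open>The bound is free of \<open>h\<close>: slope at most \<open>4 / h\<close> on an interval
  of length \<open>4 * h\<close> gives variation at most 16, and the value at \<open>R\<close> adds
  at most 1.\<close>

lemma norm_fcalc_cutoff_le:
  assumes "ac_bounded R C a" "0 < h"
  shows "norm (fcalc R a (cutoff \<mu> h)) \<le> C * 17"
proof -
  have "norm (fcalc R a (cutoff \<mu> h)) \<le> C * (1 + 2 * (2 * h) * (4 / h))"
    by (rule norm_fcalc_local_le[OF assms(1) C1_cutoff(1), where \<mu> = \<mu>])
      (use assms(2) in \<open>auto simp: C1_cutoff(2) cutoff_outside intro: cutoff_bounds\<close>)
  then show ?thesis using assms(2) by simp
qed

text \<open>The function \<open>(x - \<mu>) * cutoff \<mu> h x\<close> is at most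
  \<open>2 * h\<close> in size and has slope at most \<open>1 + 2 * h * (4 / h) = 9\<close> on an
  interval of length \<open>4 * h\<close>. This gives \<open>2 * h + 36 * h\<close>.\<close>

lemma norm_mult_fcalc_cutoff_le:
  assumes "ac_bounded R C a" "0 < h"
  shows "norm ((a - \<mu> *\<^sub>R 1) * fcalc R a (cutoff \<mu> h)) \<le> C * 38 * h"
proof -
  have lin: "C1 (\<lambda>x. x - \<mu>)" "deriv (\<lambda>x. x - \<mu>) = (\<lambda>x. 1)"
    by (rule C1I[where f' = "\<lambda>_. 1"]; auto intro!: derivative_eq_intros continuous_intros)+
  note f = C1_mult[OF lin(1) C1_cutoff(1), unfolded lin(2) C1_cutoff(2)]
  have eq: "fcalc R a (\<lambda>x. (x - \<mu>) * cutoff \<mu> h x) = (a - \<mu> *\<^sub>R 1) * fcalc R a (cutoff \<mu> h)"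
    using fcalc_mult[OF assms(1) lin(1) C1_cutoff(1)] fcalc_poly[OF assms(1), of "[:- \<mu>, 1:]"]
    by (simp add: poly_pCons[abs_def])
  have b: "\<bar>(x - \<mu>) * c\<bar> \<le> 2 * h * K" if "\<bar>c\<bar> \<le> K" "2 * h \<le> \<bar>x - \<mu>\<bar> \<Longrightarrow> c = 0" for x c K
  proof (cases "2 * h \<le> \<bar>x - \<mu>\<bar>")
    case False
    then show ?thesis using that(1) unfolding abs_mult by (intro mult_mono) auto
  qed (use that assms(2) in auto)
  have "norm (fcalc R a (\<lambda>x. (x - \<mu>) * cutoff \<mu> h x)) \<le> C * (2 * h + 2 * (2 * h) * 9)"
  proof (rule norm_fcalc_local_le[OF assms(1) f(1), where \<mu> = \<mu>])
    show "\<bar>(R - \<mu>) * cutoff \<mu> h R\<bar> \<le> 2 * h"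
      using b[OF cutoff_bounds(1) cutoff_outside(1)[OF assms(2)]] by simp
    show "\<bar>deriv (\<lambda>x. (x - \<mu>) * cutoff \<mu> h x) x\<bar> \<le> 9" for x
    proof -
      have "\<bar>(x - \<mu>) * cutoff' \<mu> h x\<bar> \<le> 2 * h * (4 / h)"
        using assms(2) by (intro b cutoff_bounds(2) cutoff_outside(2))
      then show ?thesis unfolding f(2) using cutoff_bounds(1)[of \<mu> h x] assms(2) by simp
    qed
    show "deriv (\<lambda>x. (x - \<mu>) * cutoff \<mu> h x) x = 0" if "2 * h < \<bar>x - \<mu>\<bar>" for x
      unfolding f(2) using that assms(2) by (simp add: cutoff_outside)
  qed (use assms(2) in auto)
  then show ?thesis unfolding eq by (simp add: algebra_simps)
qed

text \<open>Differences of consecutive translates of a steep \<open>step\<close> are bumps whose sum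
  telescopes.\<close>

lemma C1_partition_of_unity:
  assumes "0 < d"
  obtains k :: nat and \<tau> :: "nat \<Rightarrow> real \<Rightarrow> real"
  where "\<And>i. C1 (\<tau> i)" "\<And>x. x \<in> {-R..R} \<Longrightarrow> (\<Sum>i<k. \<tau> i x) = 1"
    "\<And>i x y. \<tau> i x \<noteq> 0 \<Longrightarrow> \<tau> i y \<noteq> 0 \<Longrightarrow> \<bar>x - y\<bar> < d"
proof -
  \<comment> \<open>Each bump has support of length at most \<open>2 / N\<close>, which is to be
    below \<open>d\<close>.\<close>
  obtain N :: nat where N: "2 / d < real N" using reals_Archimedean2 by blast
  then have N0: "0 < real N" using assms by (meson divide_pos_pos less_trans zero_less_numeral)
  \<comment> \<open>\<open>M\<close> is so large that on \<open>{-R..R}\<close> the first term of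
    the telescope is 1 and the last is 0.\<close>
  obtain M :: nat where M: "real N * \<bar>R\<bar> < real M" using reals_Archimedean2 by blast
  define \<tau> where "\<tau> i x = step (real N * x + (real M - real i + 1)) +
    (-1) * step (real N * x + (real M - real i))" for i x
  have "C1 (\<tau> i)" for i
    unfolding \<tau>_def[abs_def] by (intro C1_add(1) C1_cmult(1) C1_affine(1) C1_step(1))
  moreover have "(\<Sum>i<2 * M + 1. \<tau> i x) = 1" if "x \<in> {-R..R}" for x
  proof -
    have "real N * \<bar>x\<bar> \<le> real N * \<bar>R\<bar>"
      using that N0 by (intro mult_left_mono) auto
    with M have x: "\<bar>real N * x\<bar> < real M" by (simp add: abs_mult)
    have "(\<Sum>i<2 * M + 1. \<tau> i x) = (\<Sum>i<2 * M + 1.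
        step (real N * x + real M + 1 - real i) - step (real N * x + real M + 1 - real (Suc i)))"
      by (intro sum.cong refl) (simp add: \<tau>_def algebra_simps)
    also have "\<dots> = step (real N * x + real M + 1 - real 0) - step (real N * x + real M + 1 - real (2 * M + 1))"
      by (rule sum_lessThan_telescope')
    also have "\<dots> = 1"
      using x by (subst step_simps(2), simp) (subst step_simps(1), simp_all)
    finally show ?thesis .
  qed
  moreover have "\<bar>x - y\<bar> < d" if "\<tau> i x \<noteq> 0" "\<tau> i y \<noteq> 0" for i x y
  proof -
    have *: "\<bar>real N * z + (real M - real i)\<bar> < 1" if "\<tau> i z \<noteq> 0" for z
    proof (rule ccontr)
      assume "\<not> ?thesis"
      then consider "real N * z + (real M - real i) \<ge> 1" | "real N * z + (real M - real i) \<le> -1"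
        by linarith
      then have "\<tau> i z = 0"
      proof cases
        case 1 then show ?thesis unfolding \<tau>_def by (subst (1 2) step_simps(2)) simp_all
      next
        case 2 then show ?thesis unfolding \<tau>_def by (subst (1 2) step_simps(1)) simp_all
      qed
      with that show False by blast
    qed
    have "\<bar>real N * x - real N * y\<bar> < 2"
      using *[OF that(1)] *[OF that(2)] by linarith
    then have "real N * \<bar>x - y\<bar> < 2" using N0 by (simp add: abs_mult flip: right_diff_distrib)
    then have "\<bar>x - y\<bar> < 2 / real N" using N0 by (simp add: field_simps)
    also have "\<dots> < d" using N N0 assms by (simp add: field_simps)
    finally show ?thesis .
  qed
  ultimately show thesis by (rule that)
qed

section \<open>The algebra of operators\<close>

text \<open>A copy of the operators in which \<open>*\<close> is composition, so that the calculus
  applies. All bounded real linear operators belong to it; complex linearity enters later as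
  commutation with \<open>J\<close>.\<close>

typedef (overloaded) 'a op = "UNIV :: ('a::complex_banach \<Rightarrow>\<^sub>L 'a) set"
  morphisms blinfun_of Op ..

setup_lifting type_definition_op

instantiation op :: (complex_banach) "{real_normed_algebra, monoid_mult}"
begin

lift_definition zero_op :: "'a op" is 0 .
lift_definition one_op :: "'a op" is id_blinfun .
lift_definition plus_op :: "'a op \<Rightarrow> 'a op \<Rightarrow> 'a op" is "(+)" .
lift_definition minus_op :: "'a op \<Rightarrow> 'a op \<Rightarrow> 'a op" is "(-)" .
lift_definition uminus_op :: "'a op \<Rightarrow> 'a op" is uminus .
lift_definition times_op :: "'a op \<Rightarrow> 'a op \<Rightarrow> 'a op" is "(o\<^sub>L)" .
lift_definition scaleR_op :: "real \<Rightarrow> 'a op \<Rightarrow> 'a op" is "(*\<^sub>R)" .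
lift_definition norm_op :: "'a op \<Rightarrow> real" is norm .

definition dist_op :: "'a op \<Rightarrow> 'a op \<Rightarrow> real" where
  "dist_op a b = norm (a - b)"

definition uniformity_op :: "('a op \<times> 'a op) filter" where
  "uniformity_op = (INF e\<in>{0<..}. principal {(x, y). dist x y < e})"

definition open_op :: "'a op set \<Rightarrow> bool" where
  "open_op S = (\<forall>x\<in>S. \<forall>\<^sub>F (x', y) in uniformity. x' = x \<longrightarrow> y \<in> S)"

definition sgn_op :: "'a op \<Rightarrow> 'a op" where
  "sgn_op x = scaleR (inverse (norm x)) x"

instance
proof
  fix a b c :: "'a op" and r s :: real
  show "a + b + c = a + (b + c)" "a + b = b + a" "0 + a = a" "- a + a = 0" "a - b = a + - b"
    "r *\<^sub>R (a + b) = r *\<^sub>R a + r *\<^sub>R b" "(r + s) *\<^sub>R a = r *\<^sub>R a + s *\<^sub>R a"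
    "r *\<^sub>R s *\<^sub>R a = (r * s) *\<^sub>R a" "1 *\<^sub>R a = a"
    by (transfer, simp add: algebra_simps)+
  show "a * b * c = a * (b * c)" "1 * a = a" "a * 1 = a"
    "(a + b) * c = a * c + b * c" "a * (b + c) = a * b + a * c"
    "r *\<^sub>R a * b = r *\<^sub>R (a * b)" "a * r *\<^sub>R b = r *\<^sub>R (a * b)"
    by (transfer, rule blinfun_eqI, simp add: blinfun.bilinear_simps)+
  show "norm a = 0 \<longleftrightarrow> a = 0" by transfer simp
  show "norm (a + b) \<le> norm a + norm b" by transfer (rule norm_triangle_ineq)
  show "norm (r *\<^sub>R a) = \<bar>r\<bar> * norm a" by transfer simp
  show "norm (a * b) \<le> norm a * norm b" by transfer (rule norm_blinfun_compose)
  show "dist a b = norm (a - b)" by (rule dist_op_def)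
  show "sgn a = scaleR (inverse (norm a)) a" by (rule sgn_op_def)
  show "uniformity = (INF e\<in>{0<..}. principal {(x, y :: 'a op). dist x y < e})"
    by (rule uniformity_op_def)
  show "open S = (\<forall>x\<in>S. \<forall>\<^sub>F (x', y) in uniformity. x' = x \<longrightarrow> y \<in> S)" for S :: "'a op set"
    by (rule open_op_def)
qed

end

instance op :: (complex_banach) banach
proof
  fix X :: "nat \<Rightarrow> 'a op"
  assume "Cauchy X"
  then have "Cauchy (\<lambda>n. blinfun_of (X n))"
    unfolding Cauchy_def dist_op_def dist_norm norm_op.rep_eq minus_op.rep_eq .
  then obtain L where "(\<lambda>n. blinfun_of (X n)) \<longlonglongrightarrow> L"
    using Cauchy_convergent convergent_def by blast
  then have "X \<longlonglongrightarrow> Op L"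
    unfolding tendsto_iff dist_op_def dist_norm norm_op.rep_eq minus_op.rep_eq
    by (simp add: Op_inverse)
  then show "convergent X" by (rule convergentI)
qed

definition opapp :: "'a::complex_banach op \<Rightarrow> 'a \<Rightarrow> 'a"  (infixr "\<cdot>" 75) where
  "F \<cdot> x = blinfun_apply (blinfun_of F) x"

lemma opapp_simps:
  "(F + G) \<cdot> x = F \<cdot> x + G \<cdot> x" "(F - G) \<cdot> x = F \<cdot> x - G \<cdot> x" "(F * G) \<cdot> x = F \<cdot> G \<cdot> x"
  "(r *\<^sub>R F) \<cdot> x = r *\<^sub>R (F \<cdot> x)" "1 \<cdot> x = x" "0 \<cdot> x = 0"
  "F \<cdot> (x + y) = F \<cdot> x + F \<cdot> y" "F \<cdot> (x - y) = F \<cdot> x - F \<cdot> y" "F \<cdot> (r *\<^sub>R x) = r *\<^sub>R (F \<cdot> x)"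
  "F \<cdot> 0 = 0"
  by (simp_all add: opapp_def plus_op.rep_eq minus_op.rep_eq times_op.rep_eq scaleR_op.rep_eq
      one_op.rep_eq zero_op.rep_eq blinfun.bilinear_simps)

lemma norm_opapp_le: "norm (F \<cdot> x) \<le> norm F * norm x"
  unfolding opapp_def norm_op.rep_eq by (rule norm_blinfun)

lemma op_eqI: "(\<And>x. F \<cdot> x = G \<cdot> x) \<Longrightarrow> F = G"
  unfolding opapp_def blinfun_of_inject[symmetric] by (rule blinfun_eqI)

lemma tendsto_opapp: "(f \<longlongrightarrow> l) net \<Longrightarrow> ((\<lambda>n. F \<cdot> f n) \<longlongrightarrow> F \<cdot> l) net"
  unfolding opapp_def by (intro tendsto_intros)

section \<open>Eigenprojections of a compact operator with a splitting\<close>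

lemma norm_mult_le:
  fixes x y :: "'b::real_normed_algebra"
  shows "norm x \<le> a \<Longrightarrow> norm y \<le> b \<Longrightarrow> norm (x * y) \<le> a * b"
  by (meson mult_mono' norm_ge_zero norm_mult_ineq order_trans)

text \<open>It vanishes on a neighbourhood of 0 that shrinks with \<open>n\<close>, and so removes
  the region near 0, where compactness gives no control.\<close>

definition cutout :: "nat \<Rightarrow> real \<Rightarrow> real" where
  "cutout n x = 1 - cutoff 0 ((1 / 2) ^ n) x"

lemma C1_cutout: "C1 (cutout n)"
  unfolding cutout_def[abs_def] by (intro C1_diff C1_const C1_cutoff)

text \<open>The next function equals 1 on the support of the previous one. This allows
  \<open>real_parts_eq\<close> to split \<open>fcalc R A (cutout n)\<close> into two
  factors.\<close>

lemma cutout_mult: "cutout (Suc n) x * cutout n x = cutout n x"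
  using cutoff_mult[of "(1 / 2) ^ Suc n" "(1 / 2) ^ n" 0 x] by (simp add: cutout_def algebra_simps)

lemma cutout_near_0: "\<bar>x\<bar> < (1 / 2) ^ n \<Longrightarrow> cutout n x = 0"
  by (simp add: cutout_def cutoff_eq_1)

text \<open>The difference from \<open>a\<close> is \<open>- a * fcalc R a (cutoff 0 h)\<close> with
  \<open>h = (1 / 2) ^ n\<close>, of norm at most \<open>C * 38 * h\<close>.\<close>

lemma mult_fcalc_cutout_tendsto:
  assumes "ac_bounded R C a"
  shows "(\<lambda>n. a * fcalc R a (cutout n)) \<longlonglongrightarrow> a"
proof -
  have "fcalc R a (cutout n) = 1 - fcalc R a (cutoff 0 ((1 / 2) ^ n))" for n
    unfolding cutout_def[abs_def]
    using fcalc_diff[OF assms C1_const(1) C1_cutoff(1)] fcalc_const[OF assms, of 1] by simp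
  then have "a * fcalc R a (cutout n) - a = - ((a - 0 *\<^sub>R 1) * fcalc R a (cutoff 0 ((1 / 2) ^ n)))" for n
    by (simp add: right_diff_distrib)
  then have b: "norm (a * fcalc R a (cutout n) - a) \<le> C * 38 * (1 / 2) ^ n" for n
    using norm_mult_fcalc_cutoff_le[OF assms, of "(1 / 2) ^ n" 0] by (simp only: norm_minus_cancel) simp
  have 0: "(\<lambda>n. C * 38 * (1 / 2) ^ n) \<longlonglongrightarrow> 0"
    by (intro tendsto_eq_intros LIMSEQ_power_zero) auto
  have "(\<lambda>n. a * fcalc R a (cutout n) - a) \<longlonglongrightarrow> 0"
    by (rule Lim_null_comparison[OF always_eventually 0]) (use b in blast)
  then show ?thesis by (simp add: LIM_zero_iff)
qed

text \<open>\<open>J\<close> is multiplication by the imaginary unit, so that \<open>T = A + iB\<close>.\<close>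

locale compact_pair =
  fixes R C :: real and A B J T :: "'a::complex_banach op"
  assumes bdA: "ac_bounded R C A" and bdB: "ac_bounded R C B"
    and AB: "A * B = B * A" and JA: "J * A = A * J" and JB: "J * B = B * J"
    and JJ: "J * J = - 1" and T: "T = A + J * B"
    and cpt: "\<And>y :: nat \<Rightarrow> 'a. (\<And>n. norm (y n) \<le> 1) \<Longrightarrow> \<exists>l r. strict_mono r \<and> (\<lambda>n. T \<cdot> y (r n)) \<longlonglongrightarrow> l"
begin

definition Q :: "real \<Rightarrow> real \<Rightarrow> nat \<Rightarrow> 'a op" where
  "Q \<mu> \<nu> n = fcalc R A (cutoff \<mu> ((1 / 2) ^ n)) * fcalc R B (cutoff \<nu> ((1 / 2) ^ n))"

text \<open>\<open>SOME\<close> selects an index from which \<open>Q\<close> is constant;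
  \<open>Q_eventually_const\<close> provides one for
  \<open>(\<mu>, \<nu>) \<noteq> (0, 0)\<close>.\<close>

definition P :: "real \<Rightarrow> real \<Rightarrow> 'a op" where
  "P \<mu> \<nu> = Q \<mu> \<nu> (SOME N. \<forall>n\<ge>N. Q \<mu> \<nu> n = Q \<mu> \<nu> N)"

lemma fcalc_A_B_commute:
  assumes "C1 f" "C1 g"
  shows "fcalc R A f * fcalc R B g = fcalc R B g * fcalc R A f"
  by (intro fcalc_commute[OF bdB assms(2)] fcalc_commute[OF bdA assms(1), symmetric] AB[symmetric])

lemma fcalc_A_B_mult:
  assumes "C1 f" "C1 g" "C1 f'" "C1 g'"
  shows "fcalc R A f * fcalc R B g * (fcalc R A f' * fcalc R B g') =
    fcalc R A (\<lambda>x. f x * f' x) * fcalc R B (\<lambda>x. g x * g' x)"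
  using fcalc_A_B_commute[OF assms(3,2)]
  by (simp add: fcalc_mult[OF bdA assms(1,3)] fcalc_mult[OF bdB assms(2,4)] mult.assoc)
    (simp flip: mult.assoc)

text \<open>The strict inequality supplies the factor 2 that \<open>cutoff_mult\<close> needs. A
  single \<open>Q \<mu> \<nu> n\<close> need not be idempotent.\<close>

lemma Q_mult:
  assumes "m < n"
  shows "Q \<mu> \<nu> m * Q \<mu> \<nu> n = Q \<mu> \<nu> n" "Q \<mu> \<nu> n * Q \<mu> \<nu> m = Q \<mu> \<nu> n"
proof -
  have "(1 / 2) ^ n \<le> (1 / 2 :: real) ^ Suc m"
    using assms by (intro power_decreasing) auto
  then have *: "cutoff c ((1 / 2) ^ m) x * cutoff c ((1 / 2) ^ n) x = cutoff c ((1 / 2) ^ n) x" for c x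
    by (intro cutoff_mult) auto
  then have **: "cutoff c ((1 / 2) ^ n) x * cutoff c ((1 / 2) ^ m) x = cutoff c ((1 / 2) ^ n) x" for c x
    by (metis mult.commute)
  show "Q \<mu> \<nu> m * Q \<mu> \<nu> n = Q \<mu> \<nu> n"
    unfolding Q_def by (simp add: fcalc_A_B_mult C1_cutoff *)
  show "Q \<mu> \<nu> n * Q \<mu> \<nu> m = Q \<mu> \<nu> n"
    unfolding Q_def by (simp add: fcalc_A_B_mult C1_cutoff **)
qed

lemma norm_Q_le: "norm (Q \<mu> \<nu> n) \<le> (C * 17) * (C * 17)"
  unfolding Q_def
  by (intro norm_mult_le norm_fcalc_cutoff_le[OF bdA] norm_fcalc_cutoff_le[OF bdB]) simp_all

text \<open>One factor of \<open>Q\<close>, multiplied by \<open>A - \<mu> *\<^sub>R 1\<close>, has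
  norm of order \<open>(1 / 2) ^ n\<close>, while the other stays bounded. For \<open>B\<close> the
  two factors are interchanged first.\<close>

lemma Q_approx_eigen:
  "(\<lambda>n. (A - \<mu> *\<^sub>R 1) * Q \<mu> \<nu> n) \<longlonglongrightarrow> 0" "(\<lambda>n. (B - \<nu> *\<^sub>R 1) * Q \<mu> \<nu> n) \<longlonglongrightarrow> 0"
proof -
  have 0: "(\<lambda>n. (C * 38 * (1 / 2) ^ n) * (C * 17)) \<longlonglongrightarrow> 0"
    by (intro tendsto_eq_intros LIMSEQ_power_zero) auto
  have h: "0 < (1 / 2 :: real) ^ n" for n by simp
  have "norm ((A - \<mu> *\<^sub>R 1) * Q \<mu> \<nu> n) \<le> (C * 38 * (1 / 2) ^ n) * (C * 17)" for n
    using norm_mult_le[OF norm_mult_fcalc_cutoff_le[OF bdA h] norm_fcalc_cutoff_le[OF bdB h]]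
    unfolding Q_def by (simp only: mult.assoc[of "A - _"])
  with 0 show "(\<lambda>n. (A - \<mu> *\<^sub>R 1) * Q \<mu> \<nu> n) \<longlonglongrightarrow> 0"
    by (metis (no_types, lifting) Lim_null_comparison always_eventually)
  have "norm ((B - \<nu> *\<^sub>R 1) * Q \<mu> \<nu> n) \<le> (C * 38 * (1 / 2) ^ n) * (C * 17)" for n
    using norm_mult_le[OF norm_mult_fcalc_cutoff_le[OF bdB h] norm_fcalc_cutoff_le[OF bdA h]]
    unfolding Q_def fcalc_A_B_commute[OF C1_cutoff(1) C1_cutoff(1)]
    by (simp only: mult.assoc[of "B - _"])
  with 0 show "(\<lambda>n. (B - \<nu> *\<^sub>R 1) * Q \<mu> \<nu> n) \<longlonglongrightarrow> 0"
    by (metis (no_types, lifting) Lim_null_comparison always_eventually)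
qed

lemma J_app_J: "J \<cdot> J \<cdot> x = - x"
proof -
  have "J \<cdot> J \<cdot> x = (J * J) \<cdot> x" by (simp add: opapp_simps)
  also have "\<dots> = (0 - 1) \<cdot> x" by (simp add: JJ)
  also have "\<dots> = - x" by (simp only: opapp_simps) simp
  finally show ?thesis .
qed

text \<open>If the sequence never settles, differences of its members provide unit vectors that the
  early \<open>Q k\<close> fix and the late ones kill. They are approximate eigenvectors of
  \<open>T\<close> for a nonzero number, so compactness yields a limit vector fixed by every
  \<open>Q k\<close>. It is close to a vector killed by some \<open>Q l\<close>, against the uniform
  bound on \<open>Q\<close>.\<close>

lemma Q_eventually_const:
  assumes "(\<mu>, \<nu>) \<noteq> (0, 0)"
  shows "\<exists>N. \<forall>n\<ge>N. Q \<mu> \<nu> n = Q \<mu> \<nu> N"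
proof (rule ccontr)
  assume neg: "\<not> ?thesis"
  let ?Q = "Q \<mu> \<nu>"
  define K where "K = (C * 17) * (C * 17)"
  have K: "0 \<le> K" by (simp add: K_def)
  have "\<exists>n y. Suc j < n \<and> norm y = 1 \<and> (\<forall>k\<le>j. ?Q k \<cdot> y = y) \<and> (\<forall>l>n. ?Q l \<cdot> y = 0)" for j
  proof -
    obtain n where n: "n \<ge> Suc j" "?Q n \<noteq> ?Q (Suc j)" using neg by blast
    then have "n \<noteq> Suc j" by auto
    with n have jn: "Suc j < n" by simp
    \<comment> \<open>For \<open>k \<le> j\<close>, left multiplication by \<open>?Q k\<close>
      leaves both terms of \<open>D\<close> unchanged; for \<open>l > n\<close>, left multiplication
      by \<open>?Q l\<close> turns both into \<open>?Q l\<close>, and they cancel.\<close>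
    define D where "D = ?Q n - ?Q (Suc j)"
    have "D \<noteq> 0" using n by (simp add: D_def)
    then obtain x where x: "D \<cdot> x \<noteq> 0" using op_eqI[of D 0] by (auto simp: opapp_simps)
    define y where "y = (1 / norm (D \<cdot> x)) *\<^sub>R (D \<cdot> x)"
    have "?Q k * D = D" if "k \<le> j" for k
      using Q_mult(1)[of k n] Q_mult(1)[of k "Suc j"] that jn by (simp add: D_def algebra_simps)
    then have "?Q k \<cdot> y = y" if "k \<le> j" for k
      using that by (metis opapp_simps(3,9) y_def)
    moreover have "?Q l * D = 0" if "l > n" for l
      using Q_mult(2)[of n l] Q_mult(2)[of "Suc j" l] that jn by (simp add: D_def algebra_simps)
    then have "?Q l \<cdot> y = 0" if "l > n" for l
      using that by (metis opapp_simps(3,6,9) y_def scaleR_zero_right)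
    moreover have "norm y = 1" using x by (simp add: y_def)
    ultimately show ?thesis using jn by blast
  qed
  then obtain n y where y: "\<And>j. norm (y j) = 1" "\<And>j k. k \<le> j \<Longrightarrow> ?Q k \<cdot> y j = y j"
    "\<And>j l. l > n j \<Longrightarrow> ?Q l \<cdot> y j = 0"
    by metis
  obtain l r where r: "strict_mono (r :: nat \<Rightarrow> nat)" and l: "(\<lambda>j. T \<cdot> y (r j)) \<longlonglongrightarrow> l"
    using cpt[of y] y(1) by auto
  \<comment> \<open>As \<open>y j\<close> is fixed by \<open>?Q j\<close>, smallness of
    \<open>F * ?Q j\<close> passes to \<open>F \<cdot> y j\<close>.\<close>
  have lim0: "(\<lambda>j. F \<cdot> y j) \<longlonglongrightarrow> 0" if "(\<lambda>j. F * ?Q j) \<longlonglongrightarrow> 0" for F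
  proof (rule Lim_null_comparison[OF always_eventually])
    show "\<forall>j. norm (F \<cdot> y j) \<le> norm (F * ?Q j)"
    proof
      fix j
      have "F \<cdot> y j = (F * ?Q j) \<cdot> y j" using y(2)[of j j] by (simp add: opapp_simps)
      then show "norm (F \<cdot> y j) \<le> norm (F * ?Q j)"
        using norm_opapp_le[of "F * ?Q j" "y j"] y(1)[of j] by simp
    qed
    show "(\<lambda>j. norm (F * ?Q j)) \<longlonglongrightarrow> 0" using that tendsto_norm_zero by blast
  qed
  have "(\<lambda>j. (A - \<mu> *\<^sub>R 1) \<cdot> y j + J \<cdot> (B - \<nu> *\<^sub>R 1) \<cdot> y j) \<longlonglongrightarrow> 0 + J \<cdot> 0"
    by (intro tendsto_add tendsto_opapp lim0 Q_approx_eigen)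
  then have "(\<lambda>j. T \<cdot> y j - (\<mu> *\<^sub>R y j + \<nu> *\<^sub>R (J \<cdot> y j))) \<longlonglongrightarrow> 0"
    by (simp add: opapp_simps T algebra_simps)
  from LIMSEQ_subseq_LIMSEQ[OF this r]
  have "(\<lambda>j. T \<cdot> y (r j) - (\<mu> *\<^sub>R y (r j) + \<nu> *\<^sub>R (J \<cdot> y (r j)))) \<longlonglongrightarrow> 0"
    by (simp add: comp_def)
  from tendsto_diff[OF l this]
  have *: "(\<lambda>j. \<mu> *\<^sub>R y (r j) + \<nu> *\<^sub>R (J \<cdot> y (r j))) \<longlonglongrightarrow> l"
    by (simp add: add.commute)
  define s where "s = \<mu>\<^sup>2 + \<nu>\<^sup>2"
  have s: "s \<noteq> 0" using assms by (auto simp: s_def sum_power2_eq_zero_iff)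
  \<comment> \<open>Division by the nonzero number: multiplication by its conjugate, then division
    by the squared modulus \<open>s\<close>.\<close>
  define z where "z = (1 / s) *\<^sub>R ((\<mu> *\<^sub>R 1 - \<nu> *\<^sub>R J) \<cdot> l)"
  have "(\<lambda>j. (1 / s) *\<^sub>R ((\<mu> *\<^sub>R 1 - \<nu> *\<^sub>R J) \<cdot> (\<mu> *\<^sub>R y (r j) + \<nu> *\<^sub>R (J \<cdot> y (r j))))) \<longlonglongrightarrow> z"
    unfolding z_def by (intro tendsto_intros tendsto_opapp *)
  moreover have "(\<mu> *\<^sub>R 1 - \<nu> *\<^sub>R J) \<cdot> (\<mu> *\<^sub>R x + \<nu> *\<^sub>R (J \<cdot> x)) = s *\<^sub>R x" for x
    by (simp add: opapp_simps J_app_J s_def algebra_simps power2_eq_square)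
  ultimately have z: "(\<lambda>j. y (r j)) \<longlonglongrightarrow> z" using s by simp
  have nz: "norm z = 1"
    using tendsto_norm[OF z] y(1) by (simp add: LIMSEQ_const_iff)
  have Qz: "?Q k \<cdot> z = z" for k
  proof -
    have "\<forall>\<^sub>F j in sequentially. ?Q k \<cdot> y (r j) = y (r j)"
      using eventually_ge_at_top[of k]
      by eventually_elim (use y(2) seq_suble[OF r] le_trans in blast)
    then have "(\<lambda>j. y (r j)) \<longlonglongrightarrow> ?Q k \<cdot> z"
      using tendsto_opapp[OF z, of "?Q k"] by (rule Lim_transform_eventually[rotated])
    then show ?thesis using z LIMSEQ_unique by blast
  qed
  \<comment> \<open>\<open>K\<close> bounds the norm of every \<open>?Q l\<close>, so this distance
    leads to the contradiction \<open>1 \<le> K / (K + 1)\<close>.\<close>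
  have "0 < 1 / (K + 1)" using K by simp
  from LIMSEQ_D[OF z this] obtain j where j: "norm (y (r j) - z) < 1 / (K + 1)" by blast
  \<comment> \<open>At an index beyond \<open>n (r j)\<close> the operator kills
    \<open>y (r j)\<close> but still fixes \<open>z\<close>.\<close>
  define l where "l = Suc (n (r j))"
  have "z = ?Q l \<cdot> (z - y (r j))"
    using Qz[of l] y(3)[of "r j" l] by (simp add: opapp_simps l_def)
  then have "1 \<le> norm (?Q l) * norm (z - y (r j))"
    using norm_opapp_le[of "?Q l" "z - y (r j)"] nz by simp
  also have "\<dots> \<le> K * (1 / (K + 1))"
    using norm_Q_le[of \<mu> \<nu> l] K j by (intro mult_mono) (auto simp: K_def norm_minus_commute)
  also have "\<dots> < 1" using K by simp
  finally show False by simp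
qed

lemma Q_eventually_P:
  assumes "(\<mu>, \<nu>) \<noteq> (0, 0)"
  obtains N where "\<And>n. n \<ge> N \<Longrightarrow> Q \<mu> \<nu> n = P \<mu> \<nu>"
  using someI_ex[OF Q_eventually_const[OF assms]] unfolding P_def by blast

lemma P_eigen:
  assumes "(\<mu>, \<nu>) \<noteq> (0, 0)"
  shows "A * P \<mu> \<nu> = \<mu> *\<^sub>R P \<mu> \<nu>" "B * P \<mu> \<nu> = \<nu> *\<^sub>R P \<mu> \<nu>"
proof -
  obtain N where N: "\<And>n. n \<ge> N \<Longrightarrow> Q \<mu> \<nu> n = P \<mu> \<nu>" using Q_eventually_P[OF assms] by blast
  have *: "F * P \<mu> \<nu> = 0" if "(\<lambda>n. F * Q \<mu> \<nu> n) \<longlonglongrightarrow> 0" for F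
  proof -
    have "\<forall>\<^sub>F n in sequentially. F * Q \<mu> \<nu> n = F * P \<mu> \<nu>"
      using eventually_ge_at_top[of N] by eventually_elim (simp add: N)
    from Lim_transform_eventually[OF that this] show ?thesis by (simp add: LIMSEQ_const_iff)
  qed
  show "A * P \<mu> \<nu> = \<mu> *\<^sub>R P \<mu> \<nu>" "B * P \<mu> \<nu> = \<nu> *\<^sub>R P \<mu> \<nu>"
    using *[OF Q_approx_eigen(1)] *[OF Q_approx_eigen(2)] by (simp_all add: algebra_simps)
qed

text \<open>Two consecutive members of the constant tail turn the absorption rule
  \<open>Q_mult\<close> into idempotence.\<close>

lemma P_idem:
  assumes "(\<mu>, \<nu>) \<noteq> (0, 0)"
  shows "P \<mu> \<nu> * P \<mu> \<nu> = P \<mu> \<nu>"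
proof -
  obtain N where N: "\<And>n. n \<ge> N \<Longrightarrow> Q \<mu> \<nu> n = P \<mu> \<nu>" using Q_eventually_P[OF assms] by blast
  show ?thesis using Q_mult(1)[of N "Suc N" \<mu> \<nu>] N by simp
qed

text \<open>By its definition \<open>P\<close> is always some \<open>Q\<close>, also at
  \<open>(0, 0)\<close>, hence a product of functions of \<open>A\<close> and
  \<open>B\<close>.\<close>

lemma P_commute:
  assumes "F * A = A * F" "F * B = B * F"
  shows "F * P \<mu> \<nu> = P \<mu> \<nu> * F"
proof -
  have "F * fcalc R A f * fcalc R B g = fcalc R A f * fcalc R B g * F" if "C1 f" "C1 g" for f g
    using fcalc_commute[OF bdA that(1) assms(1)] fcalc_commute[OF bdB that(2) assms(2)]
    by (simp add: mult.assoc)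
  then show ?thesis unfolding P_def Q_def by (simp add: C1_cutoff flip: mult.assoc)
qed

lemma P_commutes: "P \<mu> \<nu> * A = A * P \<mu> \<nu>" "P \<mu> \<nu> * B = B * P \<mu> \<nu>" "P \<mu> \<nu> * J = J * P \<mu> \<nu>"
  using P_commute[of A] P_commute[of B] P_commute[of J] AB JA JB by simp_all

lemma P_T:
  assumes "(\<mu>, \<nu>) \<noteq> (0, 0)"
  shows "P \<mu> \<nu> * T = \<mu> *\<^sub>R P \<mu> \<nu> + \<nu> *\<^sub>R (J * P \<mu> \<nu>)" "T * P \<mu> \<nu> = \<mu> *\<^sub>R P \<mu> \<nu> + \<nu> *\<^sub>R (J * P \<mu> \<nu>)"
proof -
  show *: "T * P \<mu> \<nu> = \<mu> *\<^sub>R P \<mu> \<nu> + \<nu> *\<^sub>R (J * P \<mu> \<nu>)"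
    using P_eigen[OF assms] by (simp add: T algebra_simps)
  have "P \<mu> \<nu> * T = T * P \<mu> \<nu>"
    unfolding T distrib_left distrib_right using P_commutes by (metis mult.assoc)
  with * show "P \<mu> \<nu> * T = \<mu> *\<^sub>R P \<mu> \<nu> + \<nu> *\<^sub>R (J * P \<mu> \<nu>)" by simp
qed

text \<open>Multiplication by the conjugate \<open>\<mu> *\<^sub>R 1 - \<nu> *\<^sub>R J\<close>
  leaves a nonzero real multiple of \<open>X\<close>.\<close>

lemma complex_scalar_eq_0:
  assumes "\<mu> *\<^sub>R X + \<nu> *\<^sub>R (J * X) = 0" "(\<mu>, \<nu>) \<noteq> (0, 0)"
  shows "X = 0"
proof -
  have JJX: "J * (J * X) = - X" using JJ by (simp flip: mult.assoc)
  have "0 = (\<mu> *\<^sub>R 1 - \<nu> *\<^sub>R J) * (\<mu> *\<^sub>R X + \<nu> *\<^sub>R (J * X))" using assms(1) by simp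
  also have "\<dots> = (\<mu>\<^sup>2 + \<nu>\<^sup>2) *\<^sub>R X"
    by (simp add: algebra_simps JJX power2_eq_square)
  finally show ?thesis using assms(2) by (auto simp: sum_power2_eq_zero_iff)
qed

text \<open>Members may be 0, as \<open>(\<mu>, \<nu>)\<close> need not be a joint eigenvalue. The
  box is the one on which \<open>fcalc_eigen\<close> evaluates functions.\<close>

definition eigenprojections :: "'a op set" where
  "eigenprojections = {P \<mu> \<nu> | \<mu> \<nu>. \<mu> \<in> {-R..R} \<and> \<nu> \<in> {-R..R} \<and> (\<mu>, \<nu>) \<noteq> (0, 0)}"

text \<open>Where \<open>f\<close> and \<open>g\<close> live, the cutoffs in
  \<open>Q \<mu> \<nu> N\<close> are 1, so the product absorbs \<open>P \<mu> \<nu>\<close>, on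
  which it acts as the scalar \<open>f \<mu> * g \<nu>\<close>.\<close>

lemma fcalc_local_in_span:
  assumes f: "C1 f" and g: "C1 g" and 0: "(\<mu>, \<nu>) \<noteq> (0, 0)" and box: "\<mu> \<in> {-R..R}" "\<nu> \<in> {-R..R}"
    and N: "Q \<mu> \<nu> N = P \<mu> \<nu>"
    and supp: "\<And>x. f x \<noteq> 0 \<Longrightarrow> \<bar>x - \<mu>\<bar> \<le> (1 / 2) ^ N" "\<And>x. g x \<noteq> 0 \<Longrightarrow> \<bar>x - \<nu>\<bar> \<le> (1 / 2) ^ N"
  shows "fcalc R A f * fcalc R B g \<in> span eigenprojections"
proof -
  have "(\<lambda>x. f x * cutoff \<mu> ((1 / 2) ^ N) x) = f"
    using supp(1) cutoff_eq_1[of "(1 / 2) ^ N"] by fastforce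
  moreover have "(\<lambda>x. g x * cutoff \<nu> ((1 / 2) ^ N) x) = g"
    using supp(2) cutoff_eq_1[of "(1 / 2) ^ N"] by fastforce
  ultimately have "fcalc R A f * fcalc R B g = fcalc R A f * fcalc R B g * Q \<mu> \<nu> N"
    unfolding Q_def by (simp only: fcalc_A_B_mult[OF f g C1_cutoff(1) C1_cutoff(1)])
  also have "\<dots> = (g \<nu> * f \<mu>) *\<^sub>R P \<mu> \<nu>"
    unfolding N using fcalc_eigen[OF bdB g P_eigen(2)[OF 0] box(2)]
      fcalc_eigen[OF bdA f P_eigen(1)[OF 0] box(1)]
    by (simp add: mult.assoc)
  also have "\<dots> \<in> span eigenprojections"
    using 0 box by (intro span_scale span_base) (auto simp: eigenprojections_def)
  finally show ?thesis .
qed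

text \<open>Away from the origin, each point of the compact box has a window in which only one
  projection is visible. A fine partition of unity cuts the product into finitely many pieces that
  each fit into a window or vanish. The hypothesis concerns the product \<open>f x * g y\<close>, so
  one of the functions may be constant.\<close>

lemma fcalc_in_span:
  assumes f: "C1 f" and g: "C1 g" and e: "0 < \<epsilon>"
    and 0: "\<And>x y. \<bar>x\<bar> < \<epsilon> \<Longrightarrow> \<bar>y\<bar> < \<epsilon> \<Longrightarrow> f x * g y = 0"
  shows "fcalc R A f * fcalc R B g \<in> span eigenprojections"
proof -
  define Z where "Z = ({-R..R} \<times> {-R..R}) - ({-\<epsilon><..<\<epsilon>} \<times> {-\<epsilon><..<\<epsilon>})"
  have "compact Z" unfolding Z_def
    by (intro compact_diff compact_Times open_Times) auto
  have Z0: "z \<noteq> (0, 0)" if "z \<in> Z" for z using that e by (auto simp: Z_def)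
  have "\<exists>N. Q (fst z) (snd z) N = P (fst z) (snd z)" if "z \<in> Z" for z
    using Q_eventually_P[of "fst z" "snd z"] Z0[OF that] by (metis order_refl prod.collapse)
  then obtain N where N: "\<And>z. z \<in> Z \<Longrightarrow> Q (fst z) (snd z) (N z) = P (fst z) (snd z)" by metis
  define G where "G z = {fst z - (1 / 2) ^ N z<..<fst z + (1 / 2) ^ N z} \<times>
    {snd z - (1 / 2) ^ N z<..<snd z + (1 / 2) ^ N z}" for z
  have "Z \<subseteq> \<Union> (G ` Z)" by (force simp: G_def)
  moreover have "open U" if "U \<in> G ` Z" for U using that by (auto simp: G_def intro: open_Times)
  \<comment> \<open>\<open>d\<close> is a Lebesgue number of the cover by windows.\<close>
  ultimately obtain d where d: "0 < d" and dG: "\<And>z. z \<in> Z \<Longrightarrow> \<exists>U\<in>G ` Z. ball z d \<subseteq> U"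
    using Heine_Borel_lemma[OF \<open>compact Z\<close>] by metis
  obtain k \<tau> where \<tau>: "\<And>i::nat. C1 (\<tau> i)" "\<And>x. x \<in> {-R..R} \<Longrightarrow> (\<Sum>i<k. \<tau> i x) = 1"
    "\<And>i x y. \<tau> i x \<noteq> 0 \<Longrightarrow> \<tau> i y \<noteq> 0 \<Longrightarrow> \<bar>x - y\<bar> < d / 2"
    by (rule C1_partition_of_unity[OF half_gt_zero[OF d], of R]) (rule that)
  have dec: "fcalc R a h = (\<Sum>i<k. fcalc R a (\<lambda>x. h x * \<tau> i x))" if a: "ac_bounded R C a" and h: "C1 h" for a :: "'a op" and h
  proof -
    note C = C1_mult(1)[OF h \<tau>(1)]
    have "fcalc R a h = fcalc R a (\<lambda>x. \<Sum>i<k. h x * \<tau> i x)"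
      by (rule fcalc_cong_on[OF a h fcalc_sum(1)[OF a C]]) (simp add: \<tau>(2) flip: sum_distrib_left)
    then show ?thesis using fcalc_sum(2)[OF a C] by simp
  qed
  have "fcalc R A (\<lambda>x. f x * \<tau> i x) * fcalc R B (\<lambda>x. g x * \<tau> j x) \<in> span eigenprojections" for i j
  proof -
    note fC = C1_mult(1)[OF f \<tau>(1)[of i]] and gC = C1_mult(1)[OF g \<tau>(1)[of j]]
    show ?thesis
    proof (cases "\<exists>x\<in>{-R..R}. \<exists>y\<in>{-R..R}. f x * \<tau> i x \<noteq> 0 \<and> g y * \<tau> j y \<noteq> 0")
      case True
      then obtain x y where xy: "x \<in> {-R..R}" "y \<in> {-R..R}" "f x * \<tau> i x \<noteq> 0" "g y * \<tau> j y \<noteq> 0"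
        by blast
      \<comment> \<open>Since \<open>f x * g y\<close> is nonzero, the point lies outside the
        excluded square around the origin.\<close>
      with 0[of x y] have "(x, y) \<in> Z" by (force simp: Z_def)
      from dG[OF this] obtain z where z: "z \<in> Z" "ball (x, y) d \<subseteq> G z" by blast
      \<comment> \<open>Mesh \<open>d / 2\<close> in each coordinate keeps the Euclidean distance
        below \<open>d\<close>.\<close>
      have ball: "(x', y') \<in> G z" if "\<bar>x - x'\<bar> < d / 2" "\<bar>y - y'\<bar> < d / 2" for x' y'
      proof -
        have "dist (x, y) (x', y') \<le> \<bar>x - x'\<bar> + \<bar>y - y'\<bar>"
          by (simp add: dist_Pair_Pair dist_real_def sqrt_sum_squares_le_sum_abs)
        with that z show ?thesis by auto
      qed
      obtain \<mu> \<nu> where mn: "z = (\<mu>, \<nu>)" by (cases z)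
      show ?thesis
      proof (rule fcalc_local_in_span[OF fC gC])
        show "(\<mu>, \<nu>) \<noteq> (0, 0)" using Z0 z mn by blast
        show "\<mu> \<in> {-R..R}" "\<nu> \<in> {-R..R}" using z mn by (auto simp: Z_def)
        show "Q \<mu> \<nu> (N z) = P \<mu> \<nu>" using N[OF z(1)] mn by simp
        show "\<bar>x' - \<mu>\<bar> \<le> (1 / 2) ^ N z" if "f x' * \<tau> i x' \<noteq> 0" for x'
          using ball[of x' y] \<tau>(3)[of i x x'] that xy d by (auto simp: G_def mn)
        show "\<bar>y' - \<nu>\<bar> \<le> (1 / 2) ^ N z" if "g y' * \<tau> j y' \<noteq> 0" for y'
          using ball[of x y'] \<tau>(3)[of j y y'] that xy d by (auto simp: G_def mn)
      qed
    next
      case False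
      then consider "\<And>x. x \<in> {-R..R} \<Longrightarrow> f x * \<tau> i x = 0" | "\<And>y. y \<in> {-R..R} \<Longrightarrow> g y * \<tau> j y = 0"
        by blast
      then have "fcalc R A (\<lambda>x. f x * \<tau> i x) * fcalc R B (\<lambda>x. g x * \<tau> j x) = 0"
      proof cases
        case 1
        show ?thesis using fcalc_zero_on[OF bdA fC 1] by simp
      next
        case 2
        show ?thesis using fcalc_zero_on[OF bdB gC 2] by simp
      qed
      then show ?thesis by (simp add: span_zero)
    qed
  qed
  then show ?thesis
    unfolding dec[OF bdA f] dec[OF bdB g] sum_product by (intro span_sum)
qed

lemma fcalc_cutout_in_span:
  "fcalc R A (cutout n) \<in> span eigenprojections" "fcalc R B (cutout n) \<in> span eigenprojections"
  using fcalc_in_span[OF C1_cutout[of n] C1_const(1)[of 1], of "(1 / 2) ^ n"]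
    fcalc_in_span[OF C1_const(1)[of 1] C1_cutout[of n], of "(1 / 2) ^ n"]
  by (simp_all add: cutout_near_0 fcalc_const[OF bdA] fcalc_const[OF bdB])

end

section \<open>Uniqueness of the splitting\<close>

locale two_compact_pairs =
  X: compact_pair R C A B J T + Y: compact_pair R C U V J T
  for R C :: real and A B U V J T :: "'a::complex_banach op"
begin

lemma P_orthogonal:
  assumes "(\<mu>, \<nu>) \<noteq> (0, 0)" "(\<mu>', \<nu>') \<noteq> (0, 0)" "(\<mu>, \<nu>) \<noteq> (\<mu>', \<nu>')"
  shows "X.P \<mu> \<nu> * Y.P \<mu>' \<nu>' = 0"
proof (rule X.complex_scalar_eq_0[of "\<mu> - \<mu>'" _ "\<nu> - \<nu>'"])
  let ?Z = "X.P \<mu> \<nu> * Y.P \<mu>' \<nu>'"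
  have "\<mu> *\<^sub>R ?Z + \<nu> *\<^sub>R (J * ?Z) = X.P \<mu> \<nu> * T * Y.P \<mu>' \<nu>'"
    by (simp add: X.P_T[OF assms(1)] algebra_simps)
  also have "\<dots> = X.P \<mu> \<nu> * (T * Y.P \<mu>' \<nu>')" by (rule mult.assoc)
  also have "\<dots> = \<mu>' *\<^sub>R ?Z + \<nu>' *\<^sub>R (X.P \<mu> \<nu> * J * Y.P \<mu>' \<nu>')"
    by (simp add: Y.P_T[OF assms(2)] algebra_simps)
  also have "\<dots> = \<mu>' *\<^sub>R ?Z + \<nu>' *\<^sub>R (J * ?Z)"
    by (simp add: X.P_commutes mult.assoc)
  finally show "(\<mu> - \<mu>') *\<^sub>R ?Z + (\<nu> - \<nu>') *\<^sub>R (J * ?Z) = 0"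
    by (simp add: algebra_simps)
qed (use assms in auto)

text \<open>Let \<open>F\<close> run through the first family. Either \<open>F\<close> is
  \<open>X.P \<mu> \<nu>\<close> and idempotence applies, or \<open>F\<close> annihilates
  \<open>Y.P \<mu> \<nu>\<close>; in both cases \<open>X.P \<mu> \<nu>\<close> fixes
  \<open>F * Y.P \<mu> \<nu>\<close> from the left. The same holds for \<open>T\<close> in the
  limit, and its nonzero eigenvalue cancels.\<close>

lemma P_mult_left:
  assumes "(\<mu>, \<nu>) \<noteq> (0, 0)"
  shows "X.P \<mu> \<nu> * Y.P \<mu> \<nu> = Y.P \<mu> \<nu>"
proof -
  let ?P = "X.P \<mu> \<nu>" and ?P' = "Y.P \<mu> \<nu>"
  have sp: "?P * F * ?P' = F * ?P'" if "F \<in> span X.eigenprojections" for F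
    using that
  proof (induction rule: span_induct)
    case (step F)
    then obtain \<mu>' \<nu>' where F: "F = X.P \<mu>' \<nu>'" "(\<mu>', \<nu>') \<noteq> (0, 0)"
      by (auto simp: X.eigenprojections_def)
    show ?case
    proof (cases "(\<mu>', \<nu>') = (\<mu>, \<nu>)")
      case True
      then show ?thesis using F X.P_idem[OF assms] by simp
    next
      case False
      then show ?thesis using F P_orthogonal[OF F(2) assms] by (simp add: mult.assoc)
    qed
  next
    case base
    show ?case by (auto simp: subspace_def algebra_simps)
  qed
  \<comment> \<open>\<open>a * fcalc R a (cutout n)\<close> tends to \<open>a\<close>, which carries
    the identity from the span to \<open>A\<close> and \<open>B\<close>.\<close>
  have lim: "?P * a * ?P' = a * ?P'"
    if a: "ac_bounded R C a" "?P * a = a * ?P" "\<And>n. fcalc R a (cutout n) \<in> span X.eigenprojections" for a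
  proof -
    have *: "?P * (a * fcalc R a (cutout n)) * ?P' = a * fcalc R a (cutout n) * ?P'" for n
    proof -
      have "?P * (a * fcalc R a (cutout n)) * ?P' = a * (?P * fcalc R a (cutout n) * ?P')"
        by (simp add: a(2) flip: mult.assoc)
      also have "\<dots> = a * fcalc R a (cutout n) * ?P'"
        by (subst sp[OF a(3)]) (rule mult.assoc[symmetric])
      finally show ?thesis .
    qed
    have "(\<lambda>n. ?P * (a * fcalc R a (cutout n)) * ?P') \<longlonglongrightarrow> ?P * a * ?P'"
      by (intro tendsto_intros mult_fcalc_cutout_tendsto[OF a(1)])
    moreover have "(\<lambda>n. ?P * (a * fcalc R a (cutout n)) * ?P') \<longlonglongrightarrow> a * ?P'"
      unfolding * by (intro tendsto_intros mult_fcalc_cutout_tendsto[OF a(1)])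
    ultimately show ?thesis using LIMSEQ_unique by blast
  qed
  have "?P * A * ?P' = A * ?P'" "?P * B * ?P' = B * ?P'"
    by (intro lim X.bdA X.bdB X.P_commutes X.fcalc_cutout_in_span)+
  moreover have "?P * (J * B) * ?P' = J * (?P * B * ?P')"
    by (simp add: X.P_commutes(3) flip: mult.assoc)
  ultimately have "?P * T * ?P' = T * ?P'"
    unfolding X.T by (simp add: distrib_left distrib_right mult.assoc)
  then have "\<mu> *\<^sub>R (?P * ?P' - ?P') + \<nu> *\<^sub>R (J * (?P * ?P' - ?P')) = 0"
    by (simp add: X.P_T[OF assms] Y.P_T[OF assms] algebra_simps)
  from X.complex_scalar_eq_0[OF this assms] show ?thesis by simp
qed

text \<open>The mirror image of \<open>P_mult_left\<close>: the span of the second family is used,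
  and \<open>Y.P \<mu> \<nu>\<close> is absorbed on the right.\<close>

lemma P_mult_right:
  assumes "(\<mu>, \<nu>) \<noteq> (0, 0)"
  shows "X.P \<mu> \<nu> * Y.P \<mu> \<nu> = X.P \<mu> \<nu>"
proof -
  let ?P = "X.P \<mu> \<nu>" and ?P' = "Y.P \<mu> \<nu>"
  have sp: "?P * F * ?P' = ?P * F" if "F \<in> span Y.eigenprojections" for F
    using that
  proof (induction rule: span_induct)
    case (step F)
    then obtain \<mu>' \<nu>' where F: "F = Y.P \<mu>' \<nu>'" "(\<mu>', \<nu>') \<noteq> (0, 0)"
      by (auto simp: Y.eigenprojections_def)
    show ?case
    proof (cases "(\<mu>', \<nu>') = (\<mu>, \<nu>)")
      case True
      then show ?thesis using F Y.P_idem[OF assms] by (simp add: mult.assoc)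
    next
      case False
      then show ?thesis using F P_orthogonal[OF assms F(2)] by auto
    qed
  next
    case base
    show ?case by (auto simp: subspace_def algebra_simps)
  qed
  have lim: "?P * a * ?P' = ?P * a"
    if a: "ac_bounded R C a" "?P' * a = a * ?P'" "\<And>n. fcalc R a (cutout n) \<in> span Y.eigenprojections" for a
  proof -
    \<comment> \<open>Only \<open>?P'\<close> is known to commute with \<open>a\<close> here, so
      \<open>a\<close> is moved past its own calculus to stand next to \<open>?P'\<close>.\<close>
    have c: "a * fcalc R a (cutout n) = fcalc R a (cutout n) * a" for n
      by (rule fcalc_commute[OF a(1) C1_cutout refl])
    have *: "?P * (a * fcalc R a (cutout n)) * ?P' = ?P * (a * fcalc R a (cutout n))" for n
    proof -
      have "?P * (a * fcalc R a (cutout n)) * ?P' = ?P * fcalc R a (cutout n) * (a * ?P')"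
        by (simp add: c mult.assoc)
      also have "\<dots> = ?P * fcalc R a (cutout n) * ?P' * a"
        by (simp add: mult.assoc flip: a(2))
      also have "\<dots> = ?P * (a * fcalc R a (cutout n))"
        by (subst sp[OF a(3)]) (simp add: c mult.assoc)
      finally show ?thesis .
    qed
    have "(\<lambda>n. ?P * (a * fcalc R a (cutout n)) * ?P') \<longlonglongrightarrow> ?P * a * ?P'"
      by (intro tendsto_intros mult_fcalc_cutout_tendsto[OF a(1)])
    moreover have "(\<lambda>n. ?P * (a * fcalc R a (cutout n)) * ?P') \<longlonglongrightarrow> ?P * a"
      unfolding * by (intro tendsto_intros mult_fcalc_cutout_tendsto[OF a(1)])
    ultimately show ?thesis using LIMSEQ_unique by blast
  qed
  have "?P * U * ?P' = ?P * U" "?P * V * ?P' = ?P * V"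
    by (intro lim Y.bdA Y.bdB Y.P_commutes Y.fcalc_cutout_in_span)+
  moreover have "?P * (J * V) * ?P' = J * (?P * V * ?P')" "?P * (J * V) = J * (?P * V)"
    by (simp_all add: X.P_commutes(3) flip: mult.assoc)
  ultimately have "?P * T * ?P' = ?P * T"
    unfolding Y.T by (simp add: distrib_left distrib_right)
  then have "\<mu> *\<^sub>R (?P * ?P' - ?P) + \<nu> *\<^sub>R (J * (?P * ?P' - ?P)) = 0"
    by (simp add: X.P_T[OF assms] algebra_simps)
  from X.complex_scalar_eq_0[OF this assms] show ?thesis by simp
qed

lemma P_eq:
  assumes "(\<mu>, \<nu>) \<noteq> (0, 0)"
  shows "X.P \<mu> \<nu> = Y.P \<mu> \<nu>"
  using P_mult_left[OF assms] P_mult_right[OF assms] by (rule trans[OF sym, rotated])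

lemma eigenprojections_eq: "X.eigenprojections = Y.eigenprojections"
  unfolding X.eigenprojections_def Y.eigenprojections_def
  by (intro Collect_cong ex_cong1) (use P_eq in auto)

text \<open>On a common eigenprojection both calculi act as the scalar \<open>f \<mu>\<close>. Both
  orders are recorded because \<open>real_parts_eq\<close> replaces a left and a right
  factor.\<close>

lemma fcalc_mult_span:
  assumes f: "C1 f" and F: "F \<in> span X.eigenprojections"
  shows "fcalc R A f * F = fcalc R U f * F" "F * fcalc R A f = F * fcalc R U f"
proof -
  have *: "fcalc R A f * G = fcalc R U f * G \<and> G * fcalc R A f = G * fcalc R U f"
    if G: "G \<in> X.eigenprojections" for G
  proof -
    obtain \<mu> \<nu> where g: "G = X.P \<mu> \<nu>" "\<mu> \<in> {-R..R}" "(\<mu>, \<nu>) \<noteq> (0, 0)"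
      using G by (auto simp: X.eigenprojections_def)
    have g': "G = Y.P \<mu> \<nu>" using g P_eq by simp
    have "fcalc R A f * G = f \<mu> *\<^sub>R G" "G * fcalc R A f = fcalc R A f * G"
      unfolding g(1) by (intro fcalc_eigen[OF X.bdA f X.P_eigen(1)[OF g(3)] g(2)]
        fcalc_commute[OF X.bdA f X.P_commutes(1)])+
    moreover have "fcalc R U f * G = f \<mu> *\<^sub>R G" "G * fcalc R U f = fcalc R U f * G"
      unfolding g' by (intro fcalc_eigen[OF Y.bdA f Y.P_eigen(1)[OF g(3)] g(2)]
        fcalc_commute[OF Y.bdA f Y.P_commutes(1)])+
    ultimately show ?thesis by simp
  qed
  show "fcalc R A f * F = fcalc R U f * F"
    using F by (induction rule: span_induct) (auto simp: * subspace_def algebra_simps)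
  show "F * fcalc R A f = F * fcalc R U f"
    using F by (induction rule: span_induct) (auto simp: * subspace_def algebra_simps)
qed

theorem real_parts_eq: "A = U"
proof -
  have h: "fcalc R A (cutout n) = fcalc R U (cutout n)" for n
  proof -
    \<comment> \<open>The additional factor allows one factor to be replaced while the other remains
      in the span.\<close>
    have m: "fcalc R a (cutout n) = fcalc R a (cutout (Suc n)) * fcalc R a (cutout n)"
      if "ac_bounded R C a" for a :: "'a op"
      using fcalc_mult[OF that C1_cutout C1_cutout, of "Suc n" n] unfolding cutout_mult .
    have "fcalc R A (cutout n) = fcalc R A (cutout (Suc n)) * fcalc R A (cutout n)"
      by (rule m[OF X.bdA])
    also have "\<dots> = fcalc R U (cutout (Suc n)) * fcalc R A (cutout n)"
      by (rule fcalc_mult_span(1)[OF C1_cutout X.fcalc_cutout_in_span(1)])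
    also have "\<dots> = fcalc R U (cutout (Suc n)) * fcalc R U (cutout n)"
      using fcalc_mult_span(2)[OF C1_cutout] Y.fcalc_cutout_in_span(1) eigenprojections_eq by simp
    also have "\<dots> = fcalc R U (cutout n)" by (rule m[OF Y.bdA, symmetric])
    finally show ?thesis .
  qed
  \<comment> \<open>\<open>fcalc_mult_span\<close> for the identity function exchanges the outer
    factor \<open>A\<close> for \<open>U\<close>.\<close>
  have "A * fcalc R A (cutout n) = U * fcalc R U (cutout n)" for n
    using fcalc_mult_span(1)[OF C1_id X.fcalc_cutout_in_span(1), of n] h[of n]
    by (simp add: fcalc_id[OF X.bdA] fcalc_id[OF Y.bdA])
  with mult_fcalc_cutout_tendsto[OF X.bdA] mult_fcalc_cutout_tendsto[OF Y.bdA]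
  show ?thesis using LIMSEQ_unique by fastforce
qed

end

section \<open>Variation of functions of a real linear functional\<close>

lemma entry_points_affine_piece:
  assumes l: "l \<in> lines" and aff: "\<forall>s\<in>{p..q}. \<gamma> s = u + of_real s * w"
    and e: "e \<in> entry_points \<gamma> l" "e' \<in> entry_points \<gamma> l" "p < e" "e < e'" "e' \<le> q"
  shows False
proof -
  obtain c v where lv: "l = range (\<lambda>t::real. c + of_real t * v)"
    using l by (auto simp: lines_def)
  obtain a b where ab: "\<gamma> e = c + of_real a * v" "\<gamma> e' = c + of_real b * v"
    using e(1,2) by (auto simp: entry_points_def lv)
  \<comment> \<open>An affine piece with two points on the line stays on it in between, so the curve
    does not enter again at \<open>e'\<close>.\<close>
  have "\<gamma> s \<in> l" if s: "e < s" "s < e'" for s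
  proof -
    define \<theta> where "\<theta> = (s - e) / (e' - e)"
    have s_eq: "s = e + \<theta> * (e' - e)" using e(4) by (simp add: \<theta>_def)
    have "\<gamma> s = \<gamma> e + of_real \<theta> * (\<gamma> e' - \<gamma> e)"
      using aff s e by (subst s_eq) (simp add: s_eq[symmetric], simp add: s_eq algebra_simps)
    also have "\<dots> = c + of_real (a + \<theta> * (b - a)) * v"
      by (simp add: ab algebra_simps)
    finally show ?thesis unfolding lv by blast
  qed
  moreover have "\<forall>\<epsilon>>0. \<exists>s\<in>{e' - \<epsilon><..<e'} \<inter> {0..1}. \<gamma> s \<notin> l"
    using e(1,2,4) by (auto simp: entry_points_def)
  then have "\<exists>s\<in>{e' - (e' - e)<..<e'} \<inter> {0..1}. \<gamma> s \<notin> l"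
    by (rule allE[of _ "e' - e"]) (use e(4) in simp)
  ultimately show False by auto
qed

lemma strict_chain_piece:
  fixes t :: "nat \<Rightarrow> real"
  assumes "t 0 < x" "x \<le> t n"
  shows "\<exists>i<n. t i < x \<and> x \<le> t (Suc i)"
  using assms(2)
proof (induction n)
  case 0
  then show ?case using assms(1) by simp
next
  case (Suc n)
  then show ?case by (cases "x \<le> t n") (auto intro: less_SucI)
qed

text \<open>The half-open pieces cover the parameters in \<open>{0<..1}\<close>, and each holds at
  most one entry point; the parameter 0 can add one more.\<close>

lemma entry_points_bound:
  assumes "pl_curve \<gamma>"
  obtains n where "\<And>l. l \<in> lines \<Longrightarrow> finite (entry_points \<gamma> l) \<and> card (entry_points \<gamma> l) \<le> n"
proof -
  obtain n :: nat and t :: "nat \<Rightarrow> real" where t: "t 0 = 0" "t n = 1"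
    "\<And>i. i < n \<Longrightarrow> \<exists>u v. \<forall>s\<in>{t i..t (Suc i)}. \<gamma> s = u + of_real s * v"
    using assms unfolding pl_curve_def by blast
  have "finite (entry_points \<gamma> l) \<and> card (entry_points \<gamma> l) \<le> Suc n" if l: "l \<in> lines" for l
  proof -
    define S where "S i = entry_points \<gamma> l \<inter> {t i<..t (Suc i)}" for i
    have one: "x = y" if "i < n" "x \<in> S i" "y \<in> S i" for i x y
    proof -
      obtain u v where uv: "\<forall>s\<in>{t i..t (Suc i)}. \<gamma> s = u + of_real s * v"
        using t(3) \<open>i < n\<close> by blast
      show ?thesis
        using entry_points_affine_piece[OF l uv, of x y] entry_points_affine_piece[OF l uv, of y x] that(2,3)
        by (cases x y rule: linorder_cases) (auto simp: S_def)
    qed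
    have S: "finite (S i) \<and> card (S i) \<le> 1" if i: "i < n" for i
    proof (cases "S i = {}")
      case False
      then obtain x where "S i = {x}" using one[OF i] by blast
      then show ?thesis by simp
    qed simp
    have sub: "entry_points \<gamma> l \<subseteq> insert 0 (\<Union>i<n. S i)"
    proof
      fix x assume x: "x \<in> entry_points \<gamma> l"
      show "x \<in> insert 0 (\<Union>i<n. S i)"
      proof (cases "x = 0")
        case False
        with x have "0 < x" "x \<le> 1" by (auto simp: entry_points_def)
        then show ?thesis using strict_chain_piece[of t x n] t(1,2) x by (auto simp: S_def)
      qed simp
    qed
    have fin: "finite (insert 0 (\<Union>i<n. S i))" using S by auto
    have "card (insert 0 (\<Union>i<n. S i)) \<le> Suc (card (\<Union>i<n. S i))"
      by (rule card_insert_le_m1) simp_all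
    also have "card (\<Union>i<n. S i) \<le> (\<Sum>i<n. card (S i))" by (rule card_UN_le) simp
    also have "\<dots> \<le> (\<Sum>i<n. 1)" using S by (intro sum_mono) auto
    finally show ?thesis
      using card_mono[OF fin sub] finite_subset[OF sub fin] by simp
  qed
  then show thesis by (rule that)
qed

text \<open>A supremum in \<open>nat\<close> is a genuine upper bound only for a bounded set;
  \<open>entry_points_bound\<close> supplies the boundedness.\<close>

lemma card_entry_points_le_vf:
  assumes "pl_curve \<gamma>" "l \<in> lines"
  shows "finite (entry_points \<gamma> l)" "card (entry_points \<gamma> l) \<le> vf \<gamma>"
proof -
  obtain n where n: "\<And>l. l \<in> lines \<Longrightarrow> finite (entry_points \<gamma> l) \<and> card (entry_points \<gamma> l) \<le> n"
    using entry_points_bound[OF assms(1)] by blast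
  then show "finite (entry_points \<gamma> l)" using assms(2) by blast
  have "bdd_above ((\<lambda>l. card (entry_points \<gamma> l)) ` lines)"
    using n by (intro bdd_aboveI2) blast
  then show "card (entry_points \<gamma> l) \<le> vf \<gamma>"
    unfolding vf_def by (rule cSUP_upper[OF assms(2)])
qed

text \<open>Strictness places a crossing in the interior of its parameter interval, so that
  different intervals give different crossings.\<close>

definition strictly_between :: "real \<Rightarrow> real \<Rightarrow> real \<Rightarrow> bool" where
  "strictly_between x y c \<longleftrightarrow> min x y < c \<and> c < max x y"

text \<open>The least parameter with value \<open>c\<close> is taken, because the values before it
  then differ from \<open>c\<close>. This makes it an entry point on the level line.\<close>

lemma first_crossing:
  fixes h :: "real \<Rightarrow> real"
  assumes h: "continuous_on {x..y} h" and c: "strictly_between (h x) (h y) c" and xy: "x < y"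
  obtains e where "x < e" "e < y" "h e = c" "\<And>s. x \<le> s \<Longrightarrow> s < e \<Longrightarrow> h s \<noteq> c"
proof -
  define Z where "Z = {s\<in>{x..y}. h s = c}"
  have "\<exists>s\<ge>x. s \<le> y \<and> h s = c"
  proof (cases "h x \<le> h y")
    case True
    then show ?thesis using IVT'[of h x c y] c xy h by (auto simp: strictly_between_def)
  next
    case False
    then show ?thesis using IVT2'[of h y c x] c xy h by (auto simp: strictly_between_def)
  qed
  then have "Z \<noteq> {}" by (auto simp: Z_def)
  moreover have "closed Z"
    unfolding Z_def by (rule continuous_closed_preimage_constant[OF h]) simp
  moreover have "bounded Z"
    by (rule bounded_subset[of "{x..y}"]) (auto simp: Z_def)
  ultimately obtain e where e: "e \<in> Z" "\<And>s. s \<in> Z \<Longrightarrow> e \<le> s"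
    using compact_attains_inf[of Z] compact_eq_bounded_closed by blast
  have "e \<noteq> x" "e \<noteq> y" using e(1) c by (auto simp: Z_def strictly_between_def min_def max_def split: if_splits)
  moreover have "h s \<noteq> c" if "x \<le> s" "s < e" for s
    using e(2)[of s] e(1) that by (auto simp: Z_def)
  ultimately show thesis using e(1) by (intro that[of e]) (auto simp: Z_def)
qed

section \<open>Level lines of a real linear functional\<close>

definition lin :: "real \<Rightarrow> real \<Rightarrow> complex \<Rightarrow> real" where
  "lin a b z = a * Re z + b * Im z"

lemma lin_level_line:
  assumes "(a, b) \<noteq> (0, 0)"
  shows "{z. lin a b z = c} \<in> lines"
proof -
  define d where "d = a\<^sup>2 + b\<^sup>2"
  have d: "d \<noteq> 0" using assms by (auto simp: d_def sum_power2_eq_zero_iff)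
  \<comment> \<open>\<open>p\<close> is the point of the level line nearest to the origin, and
    \<open>v\<close> is orthogonal to the gradient \<open>(a, b)\<close>.\<close>
  define p where "p = Complex (c * a / d) (c * b / d)"
  define v where "v = Complex (- b) a"
  have "v \<noteq> 0" using assms by (auto simp: v_def complex_eq_iff)
  moreover have "{z. lin a b z = c} = range (\<lambda>t::real. p + of_real t * v)"
  proof (intro equalityI subsetI)
    fix z assume "z \<in> {z. lin a b z = c}"
    then have c: "c = a * Re z + b * Im z" by (simp add: lin_def)
    have "Re z * d = c * a + (a * Im z - b * Re z) * (- b)" "Im z * d = c * b + (a * Im z - b * Re z) * a"
      by (simp_all add: c d_def power2_eq_square algebra_simps)
    then have "z = p + of_real ((a * Im z - b * Re z) / d) * v"
      using d by (simp add: complex_eq_iff p_def v_def field_simps)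
    then show "z \<in> range (\<lambda>t::real. p + of_real t * v)" by blast
  next
    fix z assume "z \<in> range (\<lambda>t::real. p + of_real t * v)"
    then obtain t where z: "z = p + of_real t * v" by blast
    have "lin a b z = c * (a\<^sup>2 + b\<^sup>2) / d"
      by (simp add: z lin_def p_def v_def power2_eq_square algebra_simps add_divide_distrib)
    also have "\<dots> = c" using d unfolding d_def by (rule nonzero_mult_div_cancel_right)
    finally show "z \<in> {z. lin a b z = c}" by simp
  qed
  ultimately show ?thesis unfolding lines_def by blast
qed

text \<open>Each counted interval has an entry point on the level line in its interior. The
  interiors are disjoint, so these entry points are distinct.\<close>

lemma card_crossings_le_vf:
  assumes g: "pl_curve \<gamma>" and s: "sorted_wrt (<) s" "set s \<subseteq> {0..1}"
  shows "card {i\<in>{..<length s - 1}. strictly_between (lin a b (\<gamma> (s ! i))) (lin a b (\<gamma> (s ! Suc i))) c} \<le> vf \<gamma>"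
    (is "card ?I \<le> _")
proof (cases "(a, b) = (0, 0)")
  case True
  \<comment> \<open>For \<open>a = b = 0\<close> the level set is no line, but the functional is
    constant and crosses nothing.\<close>
  then have "?I = {}" by (auto simp: lin_def strictly_between_def)
  then show ?thesis by (simp only: card.empty)
next
  case False
  define l where "l = {z. lin a b z = c}"
  have l: "l \<in> lines" unfolding l_def by (rule lin_level_line[OF False])
  have lt: "s ! i < s ! j" if "i < j" "j < length s" for i j
    using sorted_wrt_nth_less[OF s(1) that] .
  have mem: "s ! i \<in> {0..1}" if "i < length s" for i using s(2) that nth_mem by blast
  have "\<exists>e\<in>entry_points \<gamma> l. s ! i < e \<and> e < s ! Suc i" if i: "i \<in> ?I" for i
  proof -
    have "continuous_on {0..1} (\<lambda>t. lin a b (\<gamma> t))"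
      using g unfolding lin_def pl_curve_def by (auto intro!: continuous_intros)
    then have "continuous_on {s ! i..s ! Suc i} (\<lambda>t. lin a b (\<gamma> t))"
      by (rule continuous_on_subset) (use i mem[of i] mem[of "Suc i"] in auto)
    moreover have "strictly_between (lin a b (\<gamma> (s ! i))) (lin a b (\<gamma> (s ! Suc i))) c" "s ! i < s ! Suc i"
      using i lt[of i "Suc i"] by auto
    ultimately obtain e where e: "s ! i < e" "e < s ! Suc i" "lin a b (\<gamma> e) = c"
      "\<And>t. s ! i \<le> t \<Longrightarrow> t < e \<Longrightarrow> lin a b (\<gamma> t) \<noteq> c"
      by (rule first_crossing) (rule that)
    have il: "i < length s" "Suc i < length s" using i by auto
    have "e \<in> entry_points \<gamma> l"
      unfolding entry_points_def
    proof (intro CollectI conjI disjI2 allI impI)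
      show e01: "e \<in> {0..1}" using e(1,2) mem[OF il(1)] mem[OF il(2)] by simp
      show "\<gamma> e \<in> l" by (simp add: l_def e)
      fix \<epsilon> :: real assume "\<epsilon> > 0"
      \<comment> \<open>This parameter is within \<open>\<epsilon>\<close> below \<open>e\<close>
        and not before \<open>s ! i\<close>, so the level \<open>c\<close> is not attained
        there.\<close>
      then have "max (s ! i) (e - \<epsilon> / 2) \<in> {e - \<epsilon><..<e} \<inter> {0..1}"
        using e(1) e01 mem[OF il(1)] by (auto simp: max_def)
      moreover have "\<gamma> (max (s ! i) (e - \<epsilon> / 2)) \<notin> l"
        using e(1) e(4)[of "max (s ! i) (e - \<epsilon> / 2)"] \<open>\<epsilon> > 0\<close> by (auto simp: l_def)
      ultimately show "\<exists>s\<in>{e - \<epsilon><..<e} \<inter> {0..1}. \<gamma> s \<notin> l" by blast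
    qed
    with e show ?thesis by blast
  qed
  then have "\<forall>i\<in>?I. \<exists>e. e \<in> entry_points \<gamma> l \<and> s ! i < e \<and> e < s ! Suc i"
    by (intro ballI) (simp only: Bex_def)
  from bchoice[OF this] obtain f
    where f: "\<And>i. i \<in> ?I \<Longrightarrow> f i \<in> entry_points \<gamma> l \<and> s ! i < f i \<and> f i < s ! Suc i"
    by blast
  have less: "f i < f j" if "i \<in> ?I" "j \<in> ?I" "i < j" for i j
  proof -
    have "s ! Suc i \<le> s ! j"
    proof (cases "Suc i = j")
      case False
      then have "Suc i < j" "j < length s" using that by auto
      then show ?thesis using lt less_imp_le by blast
    qed simp
    then show ?thesis using f[OF that(1)] f[OF that(2)] by linarith
  qed
  have "inj_on f ?I"
  proof (rule inj_onI, rule ccontr)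
    fix i j assume ij: "i \<in> ?I" "j \<in> ?I" "f i = f j" "i \<noteq> j"
    from \<open>i \<noteq> j\<close> consider "i < j" | "j < i" by linarith
    then show False by cases (use less[OF ij(1,2)] less[OF ij(2,1)] ij(3) in linarith)+
  qed
  then have "card ?I \<le> card (entry_points \<gamma> l)"
    using f card_entry_points_le_vf(1)[OF g l] by (intro card_inj_on_le[of f]) auto
  also have "\<dots> \<le> vf \<gamma>" by (rule card_entry_points_le_vf(2)[OF g l])
  finally show ?thesis .
qed

section \<open>Variation of a polynomial in a linear functional\<close>

definition variation_norm :: "real \<Rightarrow> real \<Rightarrow> complex poly \<Rightarrow> real" where
  "variation_norm a b p = cmod (poly p (of_real b)) +
     integral {a..b} (\<lambda>t. cmod (poly (pderiv p) (of_real t)))"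

lemma continuous_cmod_poly: "continuous_on S (\<lambda>t::real. cmod (poly p (of_real t)))"
  by (intro continuous_intros)

lemma cmod_poly_diff_le:
  assumes "x \<le> y"
  shows "cmod (poly p (of_real y) - poly p (of_real x)) \<le>
    integral {x..y} (\<lambda>t. cmod (poly (pderiv p) (of_real t)))"
proof -
  have "((\<lambda>t. poly p (of_real t)) has_vector_derivative poly (pderiv p) (of_real t)) (at t within {x..y})" for t
    by (rule has_vector_derivative_real_field) (rule poly_DERIV)
  from fundamental_theorem_of_calculus[OF assms this]
  have i: "((\<lambda>t. poly (pderiv p) (complex_of_real t)) has_integral
      poly p (of_real y) - poly p (of_real x)) {x..y}" .
  have "norm (integral {x..y} (\<lambda>t. poly (pderiv p) (complex_of_real t))) \<le>
      integral {x..y} (\<lambda>t. cmod (poly (pderiv p) (of_real t)))"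
    by (rule integral_norm_bound_integral[OF has_integral_integrable[OF i]
      integrable_continuous_interval[OF continuous_cmod_poly]]) simp
  then show ?thesis using integral_unique[OF i] by simp
qed

lemma integral_cmod_poly_nonneg: "0 \<le> integral {a..b} (\<lambda>t. cmod (poly p (of_real t)))"
  by (rule integral_nonneg) (auto intro!: integrable_continuous_interval continuous_cmod_poly)

lemma cmod_poly_le_variation_norm:
  assumes "x \<in> {a..b}"
  shows "cmod (poly p (of_real x)) \<le> variation_norm a b p"
proof -
  have "cmod (poly p (of_real x)) \<le> cmod (poly p (of_real b)) + cmod (poly p (of_real b) - poly p (of_real x))"
    by (metis norm_minus_commute norm_triangle_sub)
  also have "cmod (poly p (of_real b) - poly p (of_real x)) \<le> integral {x..b} (\<lambda>t. cmod (poly (pderiv p) (of_real t)))"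
    using assms by (intro cmod_poly_diff_le) auto
  also have "\<dots> \<le> integral {a..b} (\<lambda>t. cmod (poly (pderiv p) (of_real t)))"
    using assms by (intro integral_subset_le integrable_continuous_interval continuous_cmod_poly) auto
  finally show ?thesis by (simp add: variation_norm_def)
qed

text \<open>Every increment is written as an integral over the same \<open>{a..b}\<close>, so that a
  sum of increments can be taken under one integral. The endpoints form a null set.\<close>

lemma cmod_poly_diff_le_between:
  fixes p :: "complex poly"
  assumes "x \<in> {a..b}" "y \<in> {a..b}"
  defines "g \<equiv> \<lambda>t. cmod (poly (pderiv p) (of_real t))"
  shows "(\<lambda>t. if strictly_between x y t then g t else 0) integrable_on {a..b}"
    and "cmod (poly p (of_real y) - poly p (of_real x)) \<le>
      integral {a..b} (\<lambda>t. if strictly_between x y t then g t else 0)"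
proof -
  let ?m = "min x y" and ?M = "max x y"
  have sub: "{?m..?M} \<inter> {a..b} = {?m..?M}" using assms(1,2) by auto
  have i: "g integrable_on {?m..?M}"
    unfolding g_def by (intro integrable_continuous_interval continuous_cmod_poly)
  then have "((\<lambda>t. if t \<in> {?m..?M} then g t else 0) has_integral integral {?m..?M} g) {a..b}"
    unfolding has_integral_restrict_Int sub by (rule integrable_integral)
  then have h: "((\<lambda>t. if strictly_between x y t then g t else 0) has_integral integral {?m..?M} g) {a..b}"
    by (rule has_integral_spike_finite[rotated 2, of _ _ _ "{?m, ?M}"]) (auto simp: strictly_between_def)
  then show "(\<lambda>t. if strictly_between x y t then g t else 0) integrable_on {a..b}"
    by (rule has_integral_integrable)
  have "cmod (poly p (of_real y) - poly p (of_real x)) = cmod (poly p (of_real ?M) - poly p (of_real ?m))"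
    by (simp add: min_def max_def norm_minus_commute)
  also have "\<dots> \<le> integral {?m..?M} g" unfolding g_def by (rule cmod_poly_diff_le) simp
  finally show "cmod (poly p (of_real y) - poly p (of_real x)) \<le>
      integral {a..b} (\<lambda>t. if strictly_between x y t then g t else 0)"
    using integral_unique[OF h] by simp
qed

text \<open>After sum and integral are exchanged, the integrand at level \<open>t\<close> is the
  modulus of the derivative times the number of crossings of \<open>t\<close>, which is at most
  \<open>vf \<gamma>\<close>.\<close>

lemma sum_variation_le:
  assumes g: "pl_curve \<gamma>" and s: "sorted_wrt (<) s" "set s \<subseteq> {0..1}"
    and ran: "\<And>t. t \<in> set s \<Longrightarrow> lin c d (\<gamma> t) \<in> {a..b}"
  shows "(\<Sum>i<length s - 1. cmod (poly p (of_real (lin c d (\<gamma> (s ! Suc i)))) - poly p (of_real (lin c d (\<gamma> (s ! i))))))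
    \<le> vf \<gamma> * integral {a..b} (\<lambda>t. cmod (poly (pderiv p) (of_real t)))"
proof -
  let ?g = "\<lambda>t. cmod (poly (pderiv p) (of_real t))"
  let ?h = "\<lambda>i. lin c d (\<gamma> (s ! i))"
  let ?f = "\<lambda>i t. if strictly_between (?h i) (?h (Suc i)) t then ?g t else 0"
  have mem: "?h i \<in> {a..b}" "?h (Suc i) \<in> {a..b}" if "i \<in> {..<length s - 1}" for i
    using that by (auto intro!: ran[unfolded atLeastAtMost_iff])
  have "(\<Sum>i<length s - 1. cmod (poly p (of_real (?h (Suc i))) - poly p (of_real (?h i))))
    \<le> (\<Sum>i<length s - 1. integral {a..b} (?f i))"
    by (intro sum_mono cmod_poly_diff_le_between(2) mem)
  also have "\<dots> = integral {a..b} (\<lambda>t. \<Sum>i<length s - 1. ?f i t)"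
    by (rule integral_sum[symmetric]) (auto intro!: cmod_poly_diff_le_between(1) mem[unfolded atLeastAtMost_iff])
  also have "\<dots> \<le> integral {a..b} (\<lambda>t. vf \<gamma> * ?g t)"
  proof (rule integral_le)
    show "(\<lambda>t. \<Sum>i<length s - 1. ?f i t) integrable_on {a..b}"
      by (intro integrable_sum cmod_poly_diff_le_between(1) mem) auto
    show "(\<lambda>t. vf \<gamma> * ?g t) integrable_on {a..b}"
      by (intro integrable_continuous_interval continuous_intros)
    fix t
    have "(\<Sum>i<length s - 1. ?f i t) = real (card {i\<in>{..<length s - 1}. strictly_between (?h i) (?h (Suc i)) t}) * ?g t"
      by (simp add: sum.If_cases Int_def)
    also have "\<dots> \<le> vf \<gamma> * ?g t"
      using card_crossings_le_vf[OF g s] by (intro mult_right_mono) simp_all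
    finally show "(\<Sum>i<length s - 1. ?f i t) \<le> vf \<gamma> * ?g t" .
  qed
  finally show ?thesis by simp
qed

lemma var_poly_lin_le:
  assumes ran: "\<And>z. z \<in> \<sigma> \<Longrightarrow> lin c d z \<in> {a..b}"
  shows "var (\<lambda>z. poly p (of_real (lin c d z))) \<sigma> \<le>
    ennreal (integral {a..b} (\<lambda>t. cmod (poly (pderiv p) (of_real t))))" (is "_ \<le> ennreal ?I")
  unfolding var_def
proof (rule SUP_least)
  fix \<gamma> assume "\<gamma> \<in> Collect pl_curve"
  then have g: "pl_curve \<gamma>" by simp
  have I: "0 \<le> ?I" by (rule integral_cmod_poly_nonneg)
  have "cvar (\<lambda>z. poly p (of_real (lin c d z))) \<sigma> \<gamma> \<le> ennreal (vf \<gamma> * ?I)"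
    unfolding cvar_def using ran by (intro SUP_least ennreal_leI sum_variation_le g) auto
  then have "cvar (\<lambda>z. poly p (of_real (lin c d z))) \<sigma> \<gamma> * ennreal (rho \<gamma>) \<le> ennreal (vf \<gamma> * ?I) * ennreal (rho \<gamma>)"
    by (rule mult_right_mono) simp
  also have "\<dots> = ennreal (vf \<gamma> * ?I * rho \<gamma>)"
    using I by (intro ennreal_mult[symmetric]) (auto simp: rho_def)
  \<comment> \<open>\<open>rho\<close> cancels \<open>vf\<close>; if \<open>vf \<gamma> = 0\<close>,
    the product is simply 0.\<close>
  also have "\<dots> \<le> ennreal ?I"
    using I by (intro ennreal_leI) (cases "vf \<gamma> = 0"; simp add: rho_def)
  finally show "cvar (\<lambda>z. poly p (of_real (lin c d z))) \<sigma> \<gamma> * ennreal (rho \<gamma>) \<le> ennreal ?I" .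
qed

lemma bv_norm_poly_lin_le:
  assumes ran: "\<And>z. z \<in> \<sigma> \<Longrightarrow> lin c d z \<in> {a..b}"
  shows "bv_norm \<sigma> (\<lambda>z. poly p (of_real (lin c d z))) \<le> ennreal (2 * variation_norm a b p)"
proof -
  have 0: "0 \<le> variation_norm a b p"
    by (simp add: variation_norm_def integral_cmod_poly_nonneg)
  have "(SUP z\<in>\<sigma>. ennreal (cmod (poly p (of_real (lin c d z))))) \<le> ennreal (variation_norm a b p)"
    by (intro SUP_least ennreal_leI cmod_poly_le_variation_norm ran)
  moreover have "var (\<lambda>z. poly p (of_real (lin c d z))) \<sigma> \<le> ennreal (variation_norm a b p)"
    by (rule order_trans[OF var_poly_lin_le[OF ran]]) (auto simp: variation_norm_def intro!: ennreal_leI)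
  ultimately have "bv_norm \<sigma> (\<lambda>z. poly p (of_real (lin c d z))) \<le>
      ennreal (variation_norm a b p) + ennreal (variation_norm a b p)"
    unfolding bv_norm_def by (rule add_mono)
  also have "\<dots> = ennreal (2 * variation_norm a b p)"
    using 0 by (simp flip: ennreal_plus)
  finally show ?thesis .
qed

section \<open>Polynomials in z and its conjugate\<close>

lemma poly_z_cnj_extend:
  fixes c :: "nat \<Rightarrow> nat \<Rightarrow> complex"
  assumes "n \<le> N"
  shows "(\<Sum>i\<le>n. \<Sum>j\<le>n. c i j * z ^ i * w ^ j) =
    (\<Sum>i\<le>N. \<Sum>j\<le>N. (if i \<le> n \<and> j \<le> n then c i j else 0) * z ^ i * w ^ j)"
proof -
  have "(\<Sum>i\<le>n. \<Sum>j\<le>n. c i j * z ^ i * w ^ j) =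
      (\<Sum>i\<le>n. \<Sum>j\<le>N. (if i \<le> n \<and> j \<le> n then c i j else 0) * z ^ i * w ^ j)"
    using assms by (intro sum.cong refl sum.mono_neutral_cong_left) auto
  also have "\<dots> = (\<Sum>i\<le>N. \<Sum>j\<le>N. (if i \<le> n \<and> j \<le> n then c i j else 0) * z ^ i * w ^ j)"
    using assms by (intro sum.mono_neutral_left) auto
  finally show ?thesis .
qed

lemma poly_z_cnj_add:
  assumes "f \<in> poly_z_cnj" "g \<in> poly_z_cnj"
  shows "(\<lambda>z. f z + g z) \<in> poly_z_cnj"
proof -
  obtain n c where f: "f = (\<lambda>z. \<Sum>i\<le>n. \<Sum>j\<le>n. c i j * z ^ i * cnj z ^ j)"
    using assms(1) unfolding poly_z_cnj_def by blast
  obtain m d where g: "g = (\<lambda>z. \<Sum>i\<le>m. \<Sum>j\<le>m. d i j * z ^ i * cnj z ^ j)"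
    using assms(2) unfolding poly_z_cnj_def by blast
  have "f z + g z = (\<Sum>i\<le>max n m. \<Sum>j\<le>max n m.
      ((if i \<le> n \<and> j \<le> n then c i j else 0) + (if i \<le> m \<and> j \<le> m then d i j else 0)) * z ^ i * cnj z ^ j)" for z
    unfolding f g poly_z_cnj_extend[OF max.cobounded1[of n m], of c z "cnj z"]
      poly_z_cnj_extend[OF max.cobounded2[of m n], of d z "cnj z"]
    by (simp only: sum.distrib distrib_right)
  then have "(\<lambda>z. f z + g z) = (\<lambda>z. \<Sum>i\<le>max n m. \<Sum>j\<le>max n m.
      ((if i \<le> n \<and> j \<le> n then c i j else 0) + (if i \<le> m \<and> j \<le> m then d i j else 0)) * z ^ i * cnj z ^ j)"
    by (rule ext)
  then show ?thesis unfolding poly_z_cnj_def mem_Collect_eq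
    by (intro exI[of _ "max n m"]
        exI[of _ "\<lambda>i j. (if i \<le> n \<and> j \<le> n then c i j else 0) + (if i \<le> m \<and> j \<le> m then d i j else 0)"])
qed

lemma poly_z_cnj_cmult:
  assumes "f \<in> poly_z_cnj"
  shows "(\<lambda>z. a * f z) \<in> poly_z_cnj"
proof -
  obtain n c where f: "f = (\<lambda>z. \<Sum>i\<le>n. \<Sum>j\<le>n. c i j * z ^ i * cnj z ^ j)"
    using assms unfolding poly_z_cnj_def by blast
  show ?thesis unfolding poly_z_cnj_def mem_Collect_eq f
    by (intro exI[of _ n] exI[of _ "\<lambda>i j. a * c i j"]) (simp add: sum_distrib_left mult.assoc)
qed

lemma poly_z_cnj_mult_z:
  assumes "f \<in> poly_z_cnj"
  shows "(\<lambda>z. z * f z) \<in> poly_z_cnj" "(\<lambda>z. cnj z * f z) \<in> poly_z_cnj"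
proof -
  obtain n c where f: "f = (\<lambda>z. \<Sum>i\<le>n. \<Sum>j\<le>n. c i j * z ^ i * cnj z ^ j)"
    using assms unfolding poly_z_cnj_def by blast
  let ?e = "\<lambda>i j. if i \<le> n \<and> j \<le> n then c i j else 0"
  \<comment> \<open>Both exponents share one bound, so a shift of one of them forces the range of
    the other to be padded with zero coefficients.\<close>
  have f': "f z = (\<Sum>i\<le>n. \<Sum>j\<le>Suc n. ?e i j * z ^ i * cnj z ^ j)"
    "f z = (\<Sum>i\<le>Suc n. \<Sum>j\<le>n. ?e i j * z ^ i * cnj z ^ j)" for z
    unfolding f by (intro sum.cong refl sum.mono_neutral_cong_left; auto)
      (rule sum.mono_neutral_cong_left; auto)
  have 1: "z * f z = (\<Sum>i\<le>Suc n. \<Sum>j\<le>Suc n. (case i of 0 \<Rightarrow> 0 | Suc k \<Rightarrow> ?e k j) * z ^ i * cnj z ^ j)" for z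
    by (subst sum.atMost_Suc_shift) (simp add: f'(1) sum_distrib_left algebra_simps del: sum.atMost_Suc)
  have 2: "cnj z * f z = (\<Sum>i\<le>Suc n. \<Sum>j\<le>Suc n. (case j of 0 \<Rightarrow> 0 | Suc k \<Rightarrow> ?e i k) * z ^ i * cnj z ^ j)" for z
  proof -
    have "cnj z * f z = (\<Sum>i\<le>Suc n. \<Sum>j\<le>n. ?e i j * z ^ i * cnj z ^ Suc j)"
      by (simp add: f'(2) sum_distrib_left algebra_simps del: sum.atMost_Suc)
    also have "\<dots> = (\<Sum>i\<le>Suc n. \<Sum>j\<le>Suc n. (case j of 0 \<Rightarrow> 0 | Suc k \<Rightarrow> ?e i k) * z ^ i * cnj z ^ j)"
      by (rule sum.cong[OF refl]) (subst sum.atMost_Suc_shift, simp del: sum.atMost_Suc)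
    finally show ?thesis .
  qed
  show "(\<lambda>z. z * f z) \<in> poly_z_cnj" unfolding poly_z_cnj_def mem_Collect_eq by (intro exI ext) (rule 1)
  show "(\<lambda>z. cnj z * f z) \<in> poly_z_cnj" unfolding poly_z_cnj_def mem_Collect_eq by (intro exI ext) (rule 2)
qed

lemma poly_z_cnj_const: "(\<lambda>z. a) \<in> poly_z_cnj"
  unfolding poly_z_cnj_def mem_Collect_eq by (intro exI[of _ 0] exI[of _ "\<lambda>i j. a"]) simp

lemma poly_lin_in_poly_z_cnj: "(\<lambda>z. poly p (of_real (lin c d z))) \<in> poly_z_cnj"
proof (induction p)
  case 0
  show ?case using poly_z_cnj_const[of 0] by simp
next
  case (pCons a p)
  let ?f = "\<lambda>z. poly p (of_real (lin c d z))"
  \<comment> \<open>The functional is the real part of \<open>2 * w * z\<close>, that is,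
    \<open>w * z\<close> plus its conjugate.\<close>
  define w where "w = Complex (c / 2) (- d / 2)"
  have "complex_of_real (lin c d z) = w * z + cnj w * cnj z" for z
    by (simp add: lin_def w_def complex_eq_iff algebra_simps)
  then have "(\<lambda>z. poly (pCons a p) (of_real (lin c d z))) =
      (\<lambda>z. a + (w * (z * ?f z) + cnj w * (cnj z * ?f z)))"
    by (auto simp: algebra_simps)
  also have "\<dots> \<in> poly_z_cnj"
    by (intro poly_z_cnj_add poly_z_cnj_const poly_z_cnj_cmult poly_z_cnj_mult_z pCons)
  finally show ?case .
qed

lemma SUP_0_ennreal: "(SUP x\<in>A. 0) = (0 :: ennreal)"
  using SUP_bot by (metis bot_ennreal)

lemma bv_norm_0: "bv_norm \<sigma> (\<lambda>z. 0) = 0"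
  by (simp add: bv_norm_def var_def cvar_def SUP_0_ennreal)

lemma lin_range:
  assumes "compact \<sigma>"
  obtains a b where "a \<le> b" "\<And>z. z \<in> \<sigma> \<Longrightarrow> lin c d z \<in> {a..b}"
proof -
  have "compact (lin c d ` \<sigma>)"
    unfolding lin_def by (intro compact_continuous_image assms continuous_intros)
  then obtain M where M: "\<And>z. z \<in> \<sigma> \<Longrightarrow> \<bar>lin c d z\<bar> \<le> M"
    using compact_imp_bounded[of "lin c d ` \<sigma>"] unfolding bounded_iff by auto
  show thesis
  proof (rule that)
    \<comment> \<open>The absolute value covers an empty \<open>\<sigma>\<close>, for which
      \<open>M\<close> may be negative.\<close>
    show "- \<bar>M\<bar> \<le> \<bar>M\<bar>" by simp
    show "lin c d z \<in> {- \<bar>M\<bar>..\<bar>M\<bar>}" if "z \<in> \<sigma>" for z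
      using M[OF that] unfolding atLeastAtMost_iff by linarith
  qed
qed

text \<open>The function is its own approximant from \<open>poly_z_cnj\<close>, so only the
  finiteness of its norm is at stake.\<close>

lemma poly_lin_in_AC:
  assumes "compact \<sigma>"
  shows "(\<lambda>z. poly p (of_real (lin c d z))) \<in> AC \<sigma>"
proof -
  obtain a b where "\<And>z. z \<in> \<sigma> \<Longrightarrow> lin c d z \<in> {a..b}" using lin_range[OF assms] by blast
  from bv_norm_poly_lin_le[OF this] have "bv_norm \<sigma> (\<lambda>z. poly p (of_real (lin c d z))) < \<infinity>"
    by (metis ennreal_less_top infinity_ennreal_def order_le_less_trans)
  then show ?thesis
    unfolding AC_def BV_def mem_Collect_eq
    by (intro conjI allI impI bexI[OF _ poly_lin_in_poly_z_cnj[of p c d]]) (simp_all add: bv_norm_0)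
qed

section \<open>Operator polynomials and the functional calculus\<close>

lemma scaleC_simps:
  fixes x :: "'a::complex_banach"
  shows "0 *\<^sub>C x = 0" "1 *\<^sub>C x = x" "c *\<^sub>C 0 = (0 :: 'a)"
  using scaleC_of_real[of 0 x] scaleC_of_real[of 1 x] norm_scaleC[of c "0 :: 'a"] by simp_all

lemma poly_op_0: "poly_op 0 S = 0"
  by (simp add: poly_op_def scaleC_simps)

lemma compose_scaleC:
  fixes S :: "'a::complex_banach \<Rightarrow>\<^sub>L 'a"
  assumes "S \<in> bounded_ops"
  shows "S o\<^sub>L (c *\<^sub>C F) = c *\<^sub>C (S o\<^sub>L F)"
  using assms by (intro blinfun_eqI) (simp add: bounded_ops_def scaleC_blinfun.rep_eq)

text \<open>Complex linearity of \<open>S\<close> lets the coefficients pass through the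
  composition.\<close>

lemma poly_op_pCons:
  assumes S: "S \<in> bounded_ops"
  shows "poly_op (pCons a p) S = a *\<^sub>C id_blinfun + (S o\<^sub>L poly_op p S)"
proof -
  let ?P = "\<lambda>i. (blinfun_compose S ^^ i) id_blinfun"
  have "poly_op (pCons a p) S = (\<Sum>i\<le>Suc (degree p). coeff (pCons a p) i *\<^sub>C ?P i)"
    unfolding poly_op_def
    by (rule sum.mono_neutral_left) (use degree_pCons_le[of a p] in \<open>auto simp: coeff_eq_0 scaleC_simps\<close>)
  also have "\<dots> = a *\<^sub>C id_blinfun + (\<Sum>i\<le>degree p. coeff p i *\<^sub>C (S o\<^sub>L ?P i))"
    by (simp only: sum.atMost_Suc_shift) simp
  also have "\<dots> = a *\<^sub>C id_blinfun + (S o\<^sub>L poly_op p S)"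
    unfolding poly_op_def
    by (simp add: compose_scaleC[OF S] bounded_bilinear.sum_right[OF bounded_bilinear_blinfun_compose, of S])
  finally show ?thesis .
qed

lemma calculusD:
  assumes "AC_functional_calculus \<sigma> \<Psi>" "f \<in> AC \<sigma>"
  shows "\<Psi> f \<in> bounded_ops"
    and "\<Psi> (\<lambda>z. k * f z) = k *\<^sub>C \<Psi> f"
    and "g \<in> AC \<sigma> \<Longrightarrow> \<Psi> (\<lambda>z. f z + g z) = \<Psi> f + \<Psi> g"
    and "g \<in> AC \<sigma> \<Longrightarrow> \<Psi> (\<lambda>z. f z * g z) = \<Psi> f o\<^sub>L \<Psi> g"
    and "\<Psi> (\<lambda>z. 1) = id_blinfun"
    and "\<epsilon> > 0 \<Longrightarrow> \<exists>\<delta>>0. \<forall>g\<in>AC \<sigma>. bv_norm \<sigma> (\<lambda>z. g z - f z) < ennreal \<delta> \<longrightarrow> norm (\<Psi> g - \<Psi> f) < \<epsilon>"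
  using assms unfolding AC_functional_calculus_def by blast+

lemma calculus_poly_lin:
  fixes \<Psi> :: "(complex \<Rightarrow> complex) \<Rightarrow> ('a::complex_banach \<Rightarrow>\<^sub>L 'a)"
  assumes cpt: "compact \<sigma>" and \<Psi>: "AC_functional_calculus \<sigma> \<Psi>"
  shows "\<Psi> (\<lambda>z. poly p (of_real (lin c d z))) = poly_op p (\<Psi> (\<lambda>z. of_real (lin c d z)))"
proof -
  note AC = poly_lin_in_AC[OF cpt]
  have u: "(\<lambda>z. of_real (lin c d z)) \<in> AC \<sigma>" and one: "(\<lambda>z. 1) \<in> AC \<sigma>"
    using AC[of "[:0, 1:]" c d] AC[of "1" c d] by simp_all
  show ?thesis
  proof (induction p)
    case 0
    show ?case using calculusD(2)[OF \<Psi> one, of 0] by (simp add: poly_op_0 scaleC_simps)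
  next
    case (pCons a p)
    let ?f = "\<lambda>z. poly p (of_real (lin c d z))"
    have AC': "(\<lambda>z. a) \<in> AC \<sigma>" "(\<lambda>z. of_real (lin c d z) * ?f z) \<in> AC \<sigma>"
      using AC[of "[:a:]" c d] AC[of "pCons 0 p" c d] by simp_all
    have "\<Psi> (\<lambda>z. a) = a *\<^sub>C id_blinfun"
      using calculusD(2)[OF \<Psi> one, of a] by (simp add: calculusD(5)[OF \<Psi> one])
    then show ?case using pCons.IH
      by (simp add: poly_op_pCons[OF calculusD(1)[OF \<Psi> u]] calculusD(3)[OF \<Psi> AC']
          calculusD(4)[OF \<Psi> u AC])
  qed
qed

lemma variation_norm_smult: "variation_norm a b (smult c p) = cmod c * variation_norm a b p"
  by (simp add: variation_norm_def pderiv_smult norm_mult distrib_left)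

text \<open>Continuity of the calculus at 0 gives some \<open>\<delta>\<close>. Rescaling a
  polynomial until its \<open>bv_norm\<close> drops below \<open>\<delta>\<close> turns this into an
  estimate by \<open>variation_norm\<close>.\<close>

lemma well_bounded_calculus_lin:
  fixes \<Psi> :: "(complex \<Rightarrow> complex) \<Rightarrow> ('a::complex_banach \<Rightarrow>\<^sub>L 'a)"
  assumes cpt: "compact \<sigma>" and \<Psi>: "AC_functional_calculus \<sigma> \<Psi>"
  shows "well_bounded (\<Psi> (\<lambda>z. of_real (lin c d z)))"
proof -
  note AC = poly_lin_in_AC[OF cpt]
  let ?S = "\<Psi> (\<lambda>z. of_real (lin c d z))"
  have u: "(\<lambda>z. of_real (lin c d z)) \<in> AC \<sigma>" and zero: "(\<lambda>z. 0) \<in> AC \<sigma>"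
    using AC[of "[:0, 1:]" c d] AC[of 0 c d] by simp_all
  have S: "?S \<in> bounded_ops" by (rule calculusD(1)[OF \<Psi> u])
  have \<Psi>0: "\<Psi> (\<lambda>z. 0) = 0" using calculusD(2)[OF \<Psi> zero, of 0] by (simp add: scaleC_simps)
  obtain a b where ab: "a \<le> b" "\<And>z. z \<in> \<sigma> \<Longrightarrow> lin c d z \<in> {a..b}"
    using lin_range[OF cpt] by blast
  obtain \<delta> where \<delta>: "\<delta> > 0" "\<And>g. g \<in> AC \<sigma> \<Longrightarrow> bv_norm \<sigma> g < ennreal \<delta> \<Longrightarrow> norm (\<Psi> g) < 1"
    using calculusD(6)[OF \<Psi> zero zero_less_one] by (auto simp: \<Psi>0)
  have "norm (poly_op p ?S) \<le> (4 / \<delta>) * variation_norm a b p" for p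
  proof -
    let ?N = "variation_norm a b p"
    have N: "0 \<le> ?N" by (simp add: variation_norm_def integral_cmod_poly_nonneg)
    \<comment> \<open>\<open>?N\<close> may be 0, so a positive \<open>\<eta>\<close> is added
      before dividing; it disappears at the end through \<open>field_le_epsilon\<close>.\<close>
    have le: "norm (poly_op p ?S) \<le> (4 / \<delta>) * (?N + \<eta>)" if "\<eta> > 0" for \<eta>
    proof -
      \<comment> \<open>With this factor \<open>2 * (k * ?N)\<close> is at most
        \<open>\<delta> / 2\<close>.\<close>
      define k where "k = \<delta> / (4 * (?N + \<eta>))"
      have k: "0 < k" "2 * (k * ?N) < \<delta>"
        using N that \<delta>(1) add_pos_nonneg[of "\<delta> * (\<eta> * 4)" "\<delta> * (2 * ?N)"]
        by (simp_all add: k_def field_simps)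
      have "bv_norm \<sigma> (\<lambda>z. poly (smult (of_real k) p) (of_real (lin c d z))) \<le> ennreal (2 * (k * ?N))"
        using bv_norm_poly_lin_le[OF ab(2), where p = "smult (of_real k) p"] k(1)
        by (simp add: variation_norm_smult)
      also have "\<dots> < ennreal \<delta>" using k \<delta>(1) by (simp add: ennreal_less_iff N)
      finally have "norm (\<Psi> (\<lambda>z. poly (smult (of_real k) p) (of_real (lin c d z)))) < 1"
        by (intro \<delta>(2) AC)
      then have "k * norm (poly_op p ?S) < 1"
        using calculusD(2)[OF \<Psi> AC[of p c d], of "of_real k"] k(1)
        by (simp add: calculus_poly_lin[OF cpt \<Psi>] norm_scaleC)
      then show ?thesis using k(1) N that \<delta>(1) by (simp add: k_def field_simps)
    qed
    have "norm (poly_op p ?S) \<le> (4 / \<delta>) * ?N + e" if "e > 0" for e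
      using le[of "e * \<delta> / 4"] that \<delta>(1) by (simp add: distrib_left)
    then show ?thesis by (rule field_le_epsilon)
  qed
  with S ab(1) show ?thesis unfolding well_bounded_def variation_norm_def by blast
qed

section \<open>Splittings of compact AC operators\<close>

lemma poly_op_of_real:
  assumes S: "S \<in> bounded_ops"
  shows "Op (poly_op (map_poly complex_of_real p) S) = peval p (Op S)"
proof (induction p)
  case 0
  show ?case by (simp add: poly_op_0 zero_op.abs_eq)
next
  case (pCons a p)
  have "map_poly complex_of_real (pCons a p) = pCons (of_real a) (map_poly complex_of_real p)"
    by (rule map_poly_pCons) simp
  then show ?case
    by (simp add: poly_op_pCons[OF S] scaleC_of_real one_op.abs_eq flip: pCons.IH)
      (simp only: plus_op.abs_eq times_op.abs_eq scaleR_op.abs_eq)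
qed

lemma poly_map_of_real: "poly (map_poly complex_of_real p) (of_real x) = of_real (poly p x)"
  by (induction p) (simp_all add: map_poly_pCons)

lemma pderiv_map_of_real: "pderiv (map_poly complex_of_real p) = map_poly complex_of_real (pderiv p)"
  by (rule poly_eqI) (simp add: coeff_pderiv coeff_map_poly)

lemma variation_norm_of_real:
  "variation_norm a b (map_poly complex_of_real p) = \<bar>poly p b\<bar> + integral {a..b} (\<lambda>t. \<bar>poly (pderiv p) t\<bar>)"
  by (simp add: variation_norm_def poly_map_of_real pderiv_map_of_real)

text \<open>The value at the old endpoint \<open>b\<close> is bounded by the value at
  \<open>b'\<close> plus the integral over the added piece \<open>{b..b'}\<close>.\<close>

lemma variation_norm_mono:
  assumes "a' \<le> a" "a \<le> b" "b \<le> b'"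
  shows "variation_norm a b p \<le> variation_norm a' b' p"
proof -
  let ?g = "\<lambda>t. cmod (poly (pderiv p) (of_real t))"
  have i: "?g integrable_on {x..y}" for x y
    by (intro integrable_continuous_interval continuous_cmod_poly)
  have "cmod (poly p (of_real b)) \<le> variation_norm b b' p"
    using assms by (intro cmod_poly_le_variation_norm) auto
  moreover have "integral {a..b} ?g + integral {b..b'} ?g = integral {a..b'} ?g"
    using assms i by (intro Henstock_Kurzweil_Integration.integral_combine) auto
  moreover have "integral {a..b'} ?g \<le> integral {a'..b'} ?g"
    using assms i by (intro integral_subset_le) auto
  ultimately show ?thesis unfolding variation_norm_def by linarith
qed

text \<open>All sufficiently large parameters work, so several operators can be given common
  ones.\<close>

lemma well_bounded_imp_ac_bounded:
  assumes "well_bounded S"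
  obtains R0 C0 where "\<And>R C. R0 \<le> R \<Longrightarrow> C0 \<le> C \<Longrightarrow> ac_bounded R C (Op S)"
proof -
  obtain a b C' where S: "S \<in> bounded_ops" and ab: "a \<le> b"
    and le: "\<And>p. norm (poly_op p S) \<le> C' * variation_norm a b p"
    using assms unfolding well_bounded_def variation_norm_def by blast
  \<comment> \<open>The summand 1 makes \<open>R\<close> positive; the modulus of \<open>C'\<close>
    is used because nothing is known about its sign.\<close>
  have "ac_bounded R C (Op S)" if RC: "\<bar>a\<bar> + \<bar>b\<bar> + 1 \<le> R" "\<bar>C'\<bar> \<le> C" for R C
    unfolding ac_bounded_def
  proof (intro conjI allI)
    show "0 < R" "0 \<le> C" using RC by linarith+
    fix p
    have nn: "0 \<le> variation_norm x y q" for x y q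
      by (simp add: variation_norm_def integral_cmod_poly_nonneg)
    have "norm (peval p (Op S)) = norm (poly_op (map_poly complex_of_real p) S)"
      by (simp add: norm_op.abs_eq flip: poly_op_of_real[OF S])
    also have "\<dots> \<le> C' * variation_norm a b (map_poly complex_of_real p)" by (rule le)
    also have "\<dots> \<le> C * variation_norm (-R) R (map_poly complex_of_real p)"
      using RC ab nn by (intro mult_mono variation_norm_mono) auto
    finally show "norm (peval p (Op S)) \<le> C * (\<bar>poly p R\<bar> + integral {-R..R} (\<lambda>t. \<bar>poly (pderiv p) t\<bar>))"
      unfolding variation_norm_of_real .
  qed
  then show thesis by (rule that)
qed

lemma compact_operator_convergent_subsequence:
  assumes T: "compact_operator T" and y: "\<And>n. norm (y n) \<le> 1"
  shows "\<exists>l r. strict_mono (r :: nat \<Rightarrow> nat) \<and> (\<lambda>n. blinfun_apply T (y (r n))) \<longlonglongrightarrow> l"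
proof -
  have "\<forall>n. blinfun_apply T (y n) \<in> closure (blinfun_apply T ` cball 0 1)"
    using y by (auto intro!: closure_subset[THEN subsetD])
  then show ?thesis
    using T seq_compactE[of _ "\<lambda>n. blinfun_apply T (y n)"]
    unfolding compact_operator_def compact_eq_seq_compact_metric comp_def by metis
qed

text \<open>Complex linearity of \<open>A\<close> and \<open>B\<close> becomes commutation with
  \<open>J\<close>, the multiplication by \<open>\<i>\<close>.\<close>

lemma compact_pairI:
  assumes T: "compact_operator T" and AB: "splitting T A B"
    and bd: "ac_bounded R C (Op A)" "ac_bounded R C (Op B)"
  shows "compact_pair R C (Op A) (Op B) (Op (\<i> *\<^sub>C id_blinfun)) (Op T)"
proof
  have ops: "A \<in> bounded_ops" "B \<in> bounded_ops" and c: "A o\<^sub>L B = B o\<^sub>L A" and T_eq: "T = A + \<i> *\<^sub>C B"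
    using AB by (auto simp: splitting_def well_bounded_def)
  show "Op A * Op B = Op B * Op A" by (simp add: times_op.abs_eq c)
  show "Op (\<i> *\<^sub>C id_blinfun) * Op A = Op A * Op (\<i> *\<^sub>C id_blinfun)"
    "Op (\<i> *\<^sub>C id_blinfun) * Op B = Op B * Op (\<i> *\<^sub>C id_blinfun)"
    using ops unfolding times_op.abs_eq
    by (auto intro!: arg_cong[of _ _ Op] blinfun_eqI simp: bounded_ops_def scaleC_blinfun.rep_eq)
  show "Op (\<i> *\<^sub>C id_blinfun) * Op (\<i> *\<^sub>C id_blinfun) = (- 1 :: 'a op)"
    unfolding times_op.abs_eq one_op.abs_eq uminus_op.abs_eq
    by (rule arg_cong[of _ _ Op], rule blinfun_eqI)
      (simp add: scaleC_blinfun.rep_eq scaleC_scaleC blinfun.minus_left scaleC_of_real[of "-1", simplified])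
  show "Op T = Op A + Op (\<i> *\<^sub>C id_blinfun) * Op B"
    unfolding times_op.abs_eq plus_op.abs_eq T_eq
    by (rule arg_cong[of _ _ Op], rule blinfun_eqI) (simp add: scaleC_blinfun.rep_eq blinfun.add_left)
  show "\<exists>l r. strict_mono r \<and> (\<lambda>n. Op T \<cdot> y (r n)) \<longlonglongrightarrow> l" if "\<And>n. norm (y n) \<le> 1" for y :: "nat \<Rightarrow> 'a"
    using compact_operator_convergent_subsequence[OF T, of y] that by (simp add: opapp_def Op_inverse)
qed (fact bd)+

theorem splitting_unique:
  assumes T: "compact_operator T" and AB: "splitting T A B" and UV: "splitting T U V"
  shows "A = U \<and> B = V"
proof -
  have wb: "well_bounded A" "well_bounded B" "well_bounded U" "well_bounded V"
    using AB UV by (auto simp: splitting_def)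
  obtain R1 C1 where 1: "\<And>R C. R1 \<le> R \<Longrightarrow> C1 \<le> C \<Longrightarrow> ac_bounded R C (Op A)"
    using well_bounded_imp_ac_bounded[OF wb(1)] by blast
  obtain R2 C2 where 2: "\<And>R C. R2 \<le> R \<Longrightarrow> C2 \<le> C \<Longrightarrow> ac_bounded R C (Op B)"
    using well_bounded_imp_ac_bounded[OF wb(2)] by blast
  obtain R3 C3 where 3: "\<And>R C. R3 \<le> R \<Longrightarrow> C3 \<le> C \<Longrightarrow> ac_bounded R C (Op U)"
    using well_bounded_imp_ac_bounded[OF wb(3)] by blast
  obtain R4 C4 where 4: "\<And>R C. R4 \<le> R \<Longrightarrow> C4 \<le> C \<Longrightarrow> ac_bounded R C (Op V)"
    using well_bounded_imp_ac_bounded[OF wb(4)] by blast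
  \<comment> \<open>The maxima serve all four operators, as both locales must use the same calculus
    interval and constant.\<close>
  define R C where "R = max (max R1 R2) (max R3 R4)" and "C = max (max C1 C2) (max C3 C4)"
  have "two_compact_pairs R C (Op A) (Op B) (Op U) (Op V) (Op (\<i> *\<^sub>C id_blinfun)) (Op T)"
    unfolding two_compact_pairs_def
    by (intro conjI compact_pairI[OF T] AB UV 1 2 3 4) (auto simp: R_def C_def)
  then have "Op A = Op U" by (rule two_compact_pairs.real_parts_eq)
  then have A: "A = U" by (simp add: Op_inject)
  then have "\<i> *\<^sub>C B = \<i> *\<^sub>C V" using AB UV by (auto simp: splitting_def)
  then have "(- \<i>) *\<^sub>C \<i> *\<^sub>C B = (- \<i>) *\<^sub>C \<i> *\<^sub>C V" by simp
  then have "B = V" by (simp add: scaleC_scaleC scaleC_simps)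
  with A show ?thesis by blast
qed

section \<open>Images of real linear functionals\<close>

lemma lin_in_AC:
  assumes "compact \<sigma>"
  shows "(\<lambda>z. k * of_real (lin c d z)) \<in> AC \<sigma>" "(\<lambda>z. of_real (lin c d z)) \<in> AC \<sigma>"
  using poly_lin_in_AC[OF assms, of "[:0, k:]" c d] poly_lin_in_AC[OF assms, of "[:0, 1:]" c d]
  by (simp_all add: mult.commute)

text \<open>The images commute because the functions do, and each is well-bounded by
  \<open>well_bounded_calculus_lin\<close>.\<close>

lemma splitting_calculus_lin:
  assumes "compact \<sigma>" "AC_functional_calculus \<sigma> \<Psi>"
  defines "S \<equiv> \<lambda>c d. \<Psi> (\<lambda>z. of_real (lin c d z))"
  shows "splitting (S a b + \<i> *\<^sub>C S c d) (S a b) (S c d)"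
proof -
  note [simp] = calculusD(4)[OF assms(2) lin_in_AC(2)[OF assms(1)] lin_in_AC(2)[OF assms(1)], symmetric]
  have "S a b o\<^sub>L S c d = S c d o\<^sub>L S a b"
    unfolding S_def by (simp add: mult.commute)
  then show ?thesis
    using well_bounded_calculus_lin[OF assms(1,2)] by (simp add: splitting_def S_def)
qed

lemma calculus_lin:
  assumes "compact \<sigma>" "AC_functional_calculus \<sigma> \<Psi>"
  shows "\<Psi> (\<lambda>z. of_real (lin c d z)) =
    c *\<^sub>R \<Psi> (\<lambda>z. of_real (lin 1 0 z)) + d *\<^sub>R \<Psi> (\<lambda>z. of_real (lin 0 1 z))"
proof -
  note AC = lin_in_AC[OF assms(1)]
  have "(\<lambda>z. complex_of_real (lin c d z)) =
      (\<lambda>z. of_real c * of_real (lin 1 0 z) + of_real d * of_real (lin 0 1 z))"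
    by (simp add: lin_def)
  then show ?thesis
    by (simp only: calculusD(3)[OF assms(2) AC(1) AC(1)] calculusD(2)[OF assms(2) AC(2)] scaleC_of_real)
qed

lemma calculus_id:
  assumes "compact \<sigma>" "AC_functional_calculus \<sigma> \<Psi>"
  shows "\<Psi> (\<lambda>z. z) = \<Psi> (\<lambda>z. of_real (lin 1 0 z)) + \<i> *\<^sub>C \<Psi> (\<lambda>z. of_real (lin 0 1 z))"
proof -
  note AC = lin_in_AC[OF assms(1)]
  have "(\<lambda>z. z) = (\<lambda>z. of_real (lin 1 0 z) + \<i> * of_real (lin 0 1 z))"
    by (auto simp: fun_eq_iff lin_def complex_eq_iff)
  then show ?thesis
    by (simp only: calculusD(3)[OF assms(2) AC(2) AC(1)] calculusD(2)[OF assms(2) AC(2)])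
qed

lemma scaleC_complex_pair:
  fixes A B :: "'a::complex_banach"
  shows "(of_real \<alpha> + \<i> * of_real \<beta>) *\<^sub>C (A + \<i> *\<^sub>C B) =
    (\<alpha> *\<^sub>R A - \<beta> *\<^sub>R B) + \<i> *\<^sub>C (\<alpha> *\<^sub>R B + \<beta> *\<^sub>R A)"
proof -
  have "\<alpha> *\<^sub>R A - \<beta> *\<^sub>R B = of_real \<alpha> *\<^sub>C A + of_real (- \<beta>) *\<^sub>C B"
    by (simp only: scaleC_of_real) simp
  moreover have "(of_real \<alpha> + \<i> * of_real \<beta>) * \<i> = \<i> * of_real \<alpha> + of_real (- \<beta>)"
    by (simp add: complex_eq_iff)
  ultimately show ?thesis
    by (simp only: scaleC_add_right scaleC_scaleC scaleC_add_left flip: scaleC_of_real)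
      (simp only: add_ac)
qed

lemma compact_operator_scaleC:
  assumes "compact_operator T"
  shows "compact_operator (\<omega> *\<^sub>C T)"
proof -
  let ?K = "closure (blinfun_apply T ` cball 0 1)"
  have "continuous_on ?K (\<lambda>x. \<omega> *\<^sub>C x)"
    by (rule linear_continuous_on[OF bounded_linear_scaleC])
  then have K: "compact ((\<lambda>x. \<omega> *\<^sub>C x) ` ?K)"
    using assms unfolding compact_operator_def by (rule compact_continuous_image)
  have "blinfun_apply (\<omega> *\<^sub>C T) ` cball 0 1 \<subseteq> (\<lambda>x. \<omega> *\<^sub>C x) ` ?K"
    using closure_subset[of "blinfun_apply T ` cball 0 1"] by (auto simp: scaleC_blinfun.rep_eq)
  then have "closure (blinfun_apply (\<omega> *\<^sub>C T) ` cball 0 1) \<subseteq> (\<lambda>x. \<omega> *\<^sub>C x) ` ?K"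
    using K by (intro closure_minimal compact_imp_closed)
  with K show ?thesis
    unfolding compact_operator_def using compact_Int_closed[OF K closed_closure] by (metis Int_absorb1)
qed

theorem theorem7p3:
  fixes \<sigma> :: "complex set"
    and T A B :: "'a::complex_banach \<Rightarrow>\<^sub>L 'a"
    and \<omega> :: complex and \<alpha> \<beta> :: real
  assumes "\<sigma> \<noteq> {}" and "compact \<sigma>"
    and "AC_operator \<sigma> T" and "compact_operator T"
    and "splitting T A B"
    and "\<omega> = of_real \<alpha> + \<i> * of_real \<beta>"
  shows "splitting (\<omega> *\<^sub>C T) (\<alpha> *\<^sub>R A - \<beta> *\<^sub>R B) (\<alpha> *\<^sub>R B + \<beta> *\<^sub>R A) \<and>
    (\<forall>U V. splitting (\<omega> *\<^sub>C T) U V \<longrightarrow>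
      U = \<alpha> *\<^sub>R A - \<beta> *\<^sub>R B \<and> V = \<alpha> *\<^sub>R B + \<beta> *\<^sub>R A)"
proof -
  obtain \<Psi> where \<Psi>: "AC_functional_calculus \<sigma> \<Psi>" "\<Psi> (\<lambda>z. z) = T"
    using assms(3) unfolding AC_operator_def by blast
  let ?A = "\<Psi> (\<lambda>z. of_real (lin 1 0 z))" and ?B = "\<Psi> (\<lambda>z. of_real (lin 0 1 z))"
  have T_eq: "T = ?A + \<i> *\<^sub>C ?B"
    using calculus_id[OF assms(2) \<Psi>(1)] \<Psi>(2) by simp
  have "splitting T ?A ?B"
    unfolding T_eq by (rule splitting_calculus_lin[OF assms(2) \<Psi>(1)])
  \<comment> \<open>Uniqueness for \<open>T\<close> identifies the given \<open>A\<close> and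
    \<open>B\<close> with the images of the real and imaginary part.\<close>
  from splitting_unique[OF assms(4,5) this] have AB: "?A = A" "?B = B" by auto
  \<comment> \<open>These two functionals are the real and imaginary part of
    \<open>\<omega> * z\<close>.\<close>
  have lin: "\<Psi> (\<lambda>z. of_real (lin \<alpha> (- \<beta>) z)) = \<alpha> *\<^sub>R A - \<beta> *\<^sub>R B"
    "\<Psi> (\<lambda>z. of_real (lin \<beta> \<alpha> z)) = \<alpha> *\<^sub>R B + \<beta> *\<^sub>R A"
    using calculus_lin[OF assms(2) \<Psi>(1), of \<alpha> "- \<beta>"] calculus_lin[OF assms(2) \<Psi>(1), of \<beta> \<alpha>]
    by (simp_all add: AB)
  have "splitting (\<omega> *\<^sub>C T) (\<alpha> *\<^sub>R A - \<beta> *\<^sub>R B) (\<alpha> *\<^sub>R B + \<beta> *\<^sub>R A)"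
    using splitting_calculus_lin[OF assms(2) \<Psi>(1), of \<alpha> "- \<beta>" \<beta> \<alpha>]
    by (simp only: lin T_eq AB assms(6) scaleC_complex_pair)
  \<comment> \<open>\<open>\<omega> *\<^sub>C T\<close> is again compact, so the uniqueness theorem
    applies to it as well.\<close>
  moreover from splitting_unique[OF compact_operator_scaleC[OF assms(4)] this]
  have "U = \<alpha> *\<^sub>R A - \<beta> *\<^sub>R B \<and> V = \<alpha> *\<^sub>R B + \<beta> *\<^sub>R A" if "splitting (\<omega> *\<^sub>C T) U V" for U V
    using that by auto
  ultimately show ?thesis by blast
qed

end
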